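(* Let $n\ge 3$, $q=\frac{2n}{n-2}$, $\kappa=\frac{n-1}{n}$. Identify $S^1$ with $[-\pi,\pi]$ with endpoints identified, and let $\lambda=-1$ on $(-\pi,0)$, $\lambda=1$ on $(0,\pi)$. For $t\in\mathbb{R}$ let $\tau_t=t+\lambda$. Let $N$ be a smooth positive function on $S^1$ and let $\eta,\mu\in\mathbb{R}$. Consider the system $$-2\kappa q\,\phi''-2\eta^2\phi^{-q-1}-\kappa\Big(\mu+\tfrac{1}{2N}w'\Big)^2\phi^{-q-1}+\kappa\tau_t^2\phi^{q-1}=0,\qquad \Big(\tfrac{1}{2N}w'\Big)'-\phi^q\tau_t'=0$$ on $S^1$. Suppose $|t|>1$ and either $\mu\neq0$ or $\eta\neq0$. Then there exists at least one solution.
   Context: Here $\tau_t'=2(\delta_0-\delta_\pi)$ is the distributional derivative ($\delta_x$ the Dirac mass at $x$), and the second equation is understood in the sense of distributions. A solution is a pair $(\phi,w)\in W^{2,p}_+(S^1)\times W^{1,p}(S^1)$ for some $p>1$, where the subscript $+$ denotes positive functions. *)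

theory Defs
  imports "HOL-Analysis.Analysis"
begin

text \<open>Functions on S^1 = [-pi,pi]/(endpoints identified) are represented as
  2 pi-periodic functions on the real line.\<close>

definition periodic_S1 :: "(real \<Rightarrow> real) \<Rightarrow> bool" where
  "periodic_S1 f \<longleftrightarrow> (\<forall>x. f (x + 2 * pi) = f x)"

definition smooth_S1 :: "(real \<Rightarrow> real) \<Rightarrow> bool" where
  "smooth_S1 f \<longleftrightarrow> periodic_S1 f \<and> (\<forall>k x. ((deriv ^^ k) f) differentiable (at x))"

text \<open>W1p p f g: f lies in W^{1,p}(S^1) and g is (a periodic representative of)
  its weak derivative, i.e. f is absolutely continuous with f' = g a.e. and g in L^p.\<close>
definition W1p :: "real \<Rightarrow> (real \<Rightarrow> real) \<Rightarrow> (real \<Rightarrow> real) \<Rightarrow> bool" where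
  "W1p p f g \<longleftrightarrow> periodic_S1 f \<and> periodic_S1 g \<and>
     g \<in> borel_measurable lborel \<and>
     set_integrable lborel {-pi..pi} (\<lambda>x. \<bar>g x\<bar> powr p) \<and>
     (\<forall>x. f x = f 0 + (LBINT s=0..x. g s))"

definition lam :: "real \<Rightarrow> real" where
  "lam x = (if x < 0 then -1 else 1)"

definition q_exp :: "nat \<Rightarrow> real" where
  "q_exp n = 2 * real n / (real n - 2)"

definition kappa :: "nat \<Rightarrow> real" where
  "kappa n = (real n - 1) / real n"

text \<open>Solution of the system: phi in W^{2,p}_+(S^1) (phi' = phi1, phi'' = phi2),
  w in W^{1,p}(S^1) (w' = w1); the first equation holds a.e., the second in the
  sense of distributions, with tau_t' = 2(delta_0 - delta_pi), so that
  < phi^q tau_t', psi > = 2 phi(0)^q psi(0) - 2 phi(pi)^q psi(pi).\<close>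
definition is_solution ::
  "nat \<Rightarrow> (real \<Rightarrow> real) \<Rightarrow> real \<Rightarrow> real \<Rightarrow> real \<Rightarrow> real \<Rightarrow>
   (real \<Rightarrow> real) \<Rightarrow> (real \<Rightarrow> real) \<Rightarrow> bool" where
  "is_solution n N \<eta> \<mu> t p \<phi> w \<longleftrightarrow>
     (\<exists>\<phi>1 \<phi>2 w1.
        W1p p \<phi> \<phi>1 \<and> W1p p \<phi>1 \<phi>2 \<and> (\<forall>x. \<phi> x > 0) \<and> W1p p w w1 \<and>
        (AE x in lborel. x \<in> {-pi<..<pi} \<longrightarrow>
            - 2 * kappa n * q_exp n * \<phi>2 x
            - 2 * \<eta>\<^sup>2 * \<phi> x powr (- q_exp n - 1)
            - kappa n * (\<mu> + w1 x / (2 * N x))\<^sup>2 * \<phi> x powr (- q_exp n - 1)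
            + kappa n * (t + lam x)\<^sup>2 * \<phi> x powr (q_exp n - 1) = 0) \<and>
        (\<forall>\<psi>. smooth_S1 \<psi> \<longrightarrow>
            - (LBINT x:{-pi..pi}. w1 x / (2 * N x) * deriv \<psi> x)
            - (2 * \<phi> 0 powr q_exp n * \<psi> 0 - 2 * \<phi> pi powr q_exp n * \<psi> pi) = 0))"

end

theory Submission
  imports Defs
begin

text \<open>
  The second equation forces \<open>w' / (2 N) = \<phi>(0)\<^sup>q (\<lambda> + g)\<close> with the constant \<open>g\<close>, \<open>\<bar>g\<bar> \<le> 1\<close>, for
  which \<open>N (\<lambda> + g)\<close> has mean zero, together with \<open>\<phi>(0) = \<phi>(\<pi>)\<close>. With \<open>c = \<phi>(0)\<close> given, the first
  equation then has constant coefficients on each half circle, so we look for a \<open>\<phi>\<close> that is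
  symmetric about \<open>\<pi>/2\<close> and \<open>-\<pi>/2\<close>: on each side this is a problem on \<open>[0, \<pi>/2]\<close> with value \<open>c\<close> at
  \<open>0\<close> and vanishing derivative at \<open>\<pi>/2\<close>, whose nonlinearity is monotone. It is solved by truncation
  and a contraction argument, and the maximum principle shows that the slope at \<open>0\<close> depends
  continuously on \<open>c\<close>.

  It remains to choose \<open>c\<close> such that the two slopes cancel. For small \<open>c\<close> both are nonnegative, as
  \<open>\<mu>\<close> or \<open>\<eta>\<close> is nonzero. For large \<open>c\<close> the conserved energy gives
  \<open>q c\<^bsup>q/2\<^esup> u'(0) \<le> \<surd>A - (1 - \<epsilon>) T c\<^sup>q\<close> on each side, with \<open>T = \<bar>t \<plusminus> 1\<bar>\<close> and
  \<open>\<surd>A \<le> const + c\<^sup>q \<bar>g \<plusminus> 1\<bar>\<close>. Since \<open>\<bar>t + 1\<bar> + \<bar>t - 1\<bar> = 2 \<bar>t\<bar> > 2\<close>, the sum of the slopes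
  becomes negative, and the intermediate value theorem applies.
\<close>

section \<open>The mixed boundary value problem on an interval\<close>

text \<open>At a negative minimum \<open>m\<close> the derivative vanishes, also when
  \<open>m = L\<close> because of \<open>zL\<close>. From the last point \<open>a\<close> before
  \<open>m\<close> with \<open>z a\<close> nonnegative, \<open>z\<close> is negative, so
  \<open>dz\<close> decreases to \<open>dz m = 0\<close> and is nonnegative. Hence \<open>z\<close>
  increases from \<open>z a\<close> to \<open>z m\<close>, a contradiction. Following
  \<open>z\<close> back to \<open>a\<close> replaces a second derivative test, which would need
  strict concavity.\<close>

lemma neumann_max_principle:
  fixes z dz ddz :: "real \<Rightarrow> real"
  assumes L: "0 < L"
    and z: "\<And>x. x \<in> {0..L} \<Longrightarrow> (z has_real_derivative dz x) (at x within {0..L})"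
    and dz: "\<And>x. x \<in> {0..L} \<Longrightarrow> (dz has_real_derivative ddz x) (at x within {0..L})"
    and z0: "0 \<le> z 0" and zL: "dz L = 0"
    and neg: "\<And>x. x \<in> {0..L} \<Longrightarrow> z x < 0 \<Longrightarrow> ddz x \<le> 0"
    and x: "x \<in> {0..L}"
  shows "0 \<le> z x"
proof (rule ccontr)
  assume "\<not> 0 \<le> z x"
  have cz: "continuous_on {0..L} z" and cz1: "continuous_on {0..L} dz"
    using z dz DERIV_continuous_on by blast+
  obtain m where m: "m \<in> {0..L}" "\<And>y. y \<in> {0..L} \<Longrightarrow> z m \<le> z y"
    using continuous_attains_inf[OF _ _ cz] L by fastforce
  have zm: "z m < 0"
    using m(2)[OF x] \<open>\<not> 0 \<le> z x\<close> by linarith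
  then have m0: "0 < m"
    using m(1) z0 by (cases "m = 0") auto
  have Dz: "DERIV z y :> dz y" and Ddz: "DERIV dz y :> ddz y" if "0 < y" "y < L" for y
    using z[of y] dz[of y] that at_within_Icc_at[of 0 y L] by auto
  have z1m: "dz m = 0"
  proof (cases "m = L")
    case False
    then have "m < L" using m(1) by simp
    show ?thesis
    proof (rule DERIV_local_min)
      show "DERIV z m :> dz m" using Dz m0 \<open>m < L\<close> by blast
      show "0 < min m (L - m)" using m0 \<open>m < L\<close> by simp
      show "\<forall>y. \<bar>m - y\<bar> < min m (L - m) \<longrightarrow> z m \<le> z y"
        using m(2) by (auto simp: abs_less_iff)
    qed
  qed (use zL in simp)
  let ?S = "{y \<in> {0..m}. z y \<in> {0..}}"
  have "compact ?S"
  proof -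
    have "closed ({0..m} \<inter> z -` {0..})"
      by (rule continuous_closed_preimage) (use cz m(1) in \<open>auto intro: continuous_on_subset\<close>)
    moreover have "?S = {0..m} \<inter> z -` {0..}" by auto
    ultimately show ?thesis
      by (metis (no_types, lifting) compact_Icc compact_Int_closed inf.left_idem)
  qed
  moreover have "0 \<in> ?S" using z0 m0 by auto
  ultimately obtain a where a: "a \<in> ?S" "\<And>y. y \<in> ?S \<Longrightarrow> y \<le> a"
    using compact_attains_sup[of ?S] by blast
  have am: "a < m" using a(1) zm by (cases "a = m") auto
  have a0: "0 \<le> a" using a(1) by simp
  have zneg: "z y < 0" if "a < y" "y \<le> m" for y
    using a(2)[of y] a0 that by force
  have z1pos: "0 \<le> dz y" if "a < y" "y < m" for y
  proof -
    have "dz m \<le> dz y"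
    proof (rule DERIV_nonpos_imp_decreasing_open[where f = dz])
      fix s assume "y < s" "s < m"
      then show "\<exists>d. DERIV dz s :> d \<and> d \<le> 0"
        using Ddz[of s] neg[of s] zneg[of s] a0 that m(1) by auto
    qed (use that a0 m(1) in \<open>auto intro: continuous_on_subset[OF cz1]\<close>)
    then show ?thesis using z1m by simp
  qed
  have "z a \<le> z m"
  proof (rule DERIV_nonneg_imp_increasing_open[where f = z])
    fix s assume "a < s" "s < m"
    then show "\<exists>d. DERIV z s :> d \<and> 0 \<le> d"
      using Dz[of s] z1pos[of s] a0 m(1) by auto
  qed (use am a0 m(1) in \<open>auto intro: continuous_on_subset[OF cz]\<close>)
  with zm a(1) show False by auto
qed

text \<open>Dirichlet datum at the matching point \<open>0\<close>, Neumann condition at the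
  symmetry point \<open>L\<close>. Derivatives are taken within the closed interval, so they are
  one-sided at the ends and can be joined after reflection.\<close>

definition mixed_bvp ::
  "real \<Rightarrow> (real \<Rightarrow> real) \<Rightarrow> real \<Rightarrow> (real \<Rightarrow> real) \<Rightarrow> (real \<Rightarrow> real) \<Rightarrow> bool" where
  "mixed_bvp L f c u u1 \<longleftrightarrow> u 0 = c \<and> u1 L = 0 \<and>
     (\<forall>x\<in>{0..L}. (u has_real_derivative u1 x) (at x within {0..L}) \<and>
                  (u1 has_real_derivative f (u x)) (at x within {0..L}))"

text \<open>Explicit Green function, built from \<open>sinh (k * x)\<close>, which vanishes at
  \<open>0\<close>, and \<open>cosh (k * (L - x))\<close>, which has zero slope at
  \<open>L\<close>.\<close>

lemma linear_mixed_bvp: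
  fixes g :: "real \<Rightarrow> real"
  assumes L: "0 < L" and k: "0 < k" and g: "continuous_on {0..L} g"
  obtains u u1 where "u 0 = c" "u1 L = 0"
    "\<And>x. x \<in> {0..L} \<Longrightarrow> (u has_real_derivative u1 x) (at x within {0..L})"
    "\<And>x. x \<in> {0..L} \<Longrightarrow> (u1 has_real_derivative k\<^sup>2 * u x - g x) (at x within {0..L})"
proof -
  define P where "P x = integral {0..x} (\<lambda>s. sinh (k * s) * g s)" for x
  define R where "R x = integral {0..x} (\<lambda>s. cosh (k * (L - s)) * g s)" for x
  have P: "(P has_real_derivative sinh (k * x) * g x) (at x within {0..L})" if "x \<in> {0..L}" for x
    unfolding P_def using that by (intro integral_has_real_derivative continuous_intros g)
  have R: "(R has_real_derivative cosh (k * (L - x)) * g x) (at x within {0..L})" if "x \<in> {0..L}" for x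
    unfolding R_def using that by (intro integral_has_real_derivative continuous_intros g)
  have P0: "P 0 = 0" by (simp add: P_def)
  have ch: "cosh (k * L) \<noteq> 0" using cosh_real_pos[of "k * L"] by linarith
  define i where "i = 1 / cosh (k * L)"
  define C where "C x = cosh (k * (L - x))" for x
  define S where "S x = sinh (k * (L - x))" for x
  define u where "u x = (c * C x + (C x * P x + sinh (k * x) * (R L - R x)) / k) * i" for x
  define u1 where "u1 x = (- c * k * S x - S x * P x + cosh (k * x) * (R L - R x)) * i" for x
  have C: "(C has_real_derivative - k * S x) (at x within {0..L})" for x
    unfolding C_def S_def by (auto intro!: derivative_eq_intros)
  have S: "(S has_real_derivative - k * C x) (at x within {0..L})" for x
    unfolding C_def S_def by (auto intro!: derivative_eq_intros)
  \<comment> \<open>The Wronskian of the two homogeneous solutions, normalised; it becomes the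
    coefficient of \<open>g\<close> in the second derivative.\<close>
  have cs: "(cosh (k * x) * C x + sinh (k * x) * S x) * i = 1" for x
    using cosh_add[of "k * x" "k * (L - x)"] ch by (simp add: algebra_simps C_def S_def i_def)
  show ?thesis
  proof
    show "u 0 = c" using ch k by (simp add: u_def P0 C_def i_def)
    show "u1 L = 0" by (simp add: u1_def S_def)
    fix x assume x: "x \<in> {0..L}"
    note C' = C[of x] and S' = S[of x] and P' = P[OF x] and R' = R[OF x]
    have "((\<lambda>x. sinh (k * x)) has_real_derivative k * cosh (k * x)) (at x within {0..L})"
      "((\<lambda>x. cosh (k * x)) has_real_derivative k * sinh (k * x)) (at x within {0..L})"
      by (auto intro!: derivative_eq_intros)
    note hyp = this
    have "(u has_real_derivative (c * (- k * S x) + (((- k * S x) * P x + (sinh (k * x) * g x) * C x)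
        + ((k * cosh (k * x)) * (R L - R x) + (0 - C x * g x) * sinh (k * x))) / k) * i) (at x within {0..L})"
      unfolding u_def
      by (intro DERIV_cmult_right DERIV_add DERIV_cmult DERIV_cdivide DERIV_mult DERIV_diff DERIV_const
          C' S' P' hyp R'[folded C_def])
    moreover have "(c * (- k * S x) + (((- k * S x) * P x + (sinh (k * x) * g x) * C x)
        + ((k * cosh (k * x)) * (R L - R x) + (0 - C x * g x) * sinh (k * x))) / k) * i = u1 x"
      unfolding u1_def using k by (simp add: field_simps)
    ultimately show "(u has_real_derivative u1 x) (at x within {0..L})" by simp
    have "(u1 has_real_derivative ((- c * k) * (- k * C x) - ((- k * C x) * P x + (sinh (k * x) * g x) * S x)
        + ((k * sinh (k * x)) * (R L - R x) + (0 - C x * g x) * cosh (k * x))) * i) (at x within {0..L})"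
      unfolding u1_def
      by (intro DERIV_cmult_right DERIV_add DERIV_cmult DERIV_mult DERIV_diff DERIV_const
          C' S' P' hyp R'[folded C_def])
    moreover have "((- c * k) * (- k * C x) - ((- k * C x) * P x + (sinh (k * x) * g x) * S x)
        + ((k * sinh (k * x)) * (R L - R x) + (0 - C x * g x) * cosh (k * x))) * i
        = k\<^sup>2 * u x - g x * ((cosh (k * x) * C x + sinh (k * x) * S x) * i)"
      unfolding u_def using k by (simp add: field_simps power2_eq_square)
    ultimately show "(u1 has_real_derivative k\<^sup>2 * u x - g x) (at x within {0..L})"
      unfolding cs by simp
  qed
qed

text \<open>Write the equation as \<open>u'' - k\<^sup>2 u = - (k\<^sup>2 u - f u)\<close> and
  iterate the linear solver. Both hypotheses on \<open>f\<close> together make the right-hand side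
  \<open>k\<^sup>2\<close>-Lipschitz, and comparison with a barrier makes the iteration a
  contraction for every length \<open>L\<close>.\<close>

lemma lipschitz_mixed_bvp:
  fixes f :: "real \<Rightarrow> real"
  assumes L: "0 < L" and k: "0 < k"
    and f: "\<And>a b. a \<le> b \<Longrightarrow> f a \<le> f b" "\<And>a b. a \<le> b \<Longrightarrow> f b - f a \<le> k\<^sup>2 * (b - a)"
  shows "\<exists>u u1. mixed_bvp L f c u u1"
proof -
  have lip: "\<bar>(k\<^sup>2 * b - f b) - (k\<^sup>2 * a - f a)\<bar> \<le> k\<^sup>2 * \<bar>b - a\<bar>" for a b
  proof (cases "a \<le> b")
    case True
    then show ?thesis using f(1)[OF True] f(2)[OF True] by (simp add: abs_le_iff algebra_simps)
  next
    case False
    then have "b \<le> a" by simp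
    then show ?thesis using f(1)[of b a] f(2)[of b a] by (simp add: abs_le_iff algebra_simps)
  qed
  have cont: "continuous_on UNIV (\<lambda>x. k\<^sup>2 * x - f x)"
  proof (rule lipschitz_on_continuous_on)
    show "(k\<^sup>2)-lipschitz_on UNIV (\<lambda>x. k\<^sup>2 * x - f x)"
      by (rule lipschitz_onI) (use lip in \<open>auto simp: dist_real_def abs_minus_commute\<close>)
  qed
  \<comment> \<open>Extending functions on \<open>{0..L}\<close> by their end values places them in
    the complete space of bounded continuous functions on the line.\<close>
  define clip where "clip x = max 0 (min L x)" for x
  have clip: "clip x \<in> {0..L}" for x using L by (auto simp: clip_def)
  have clip_id: "clip x = x" if "x \<in> {0..L}" for x using that by (auto simp: clip_def)
  have "\<exists>w::real \<Rightarrow>\<^sub>C real. \<exists>w1. w 0 = c \<and> w1 L = 0 \<and> (\<forall>x. w x = w (clip x)) \<and>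
      (\<forall>x\<in>{0..L}. (w has_real_derivative w1 x) (at x within {0..L}) \<and>
        (w1 has_real_derivative k\<^sup>2 * w x - (k\<^sup>2 * v x - f (v x))) (at x within {0..L}))"
    for v :: "real \<Rightarrow>\<^sub>C real"
  proof -
    have "continuous_on {0..L} (\<lambda>x. k\<^sup>2 * v x - f (v x))"
      by (rule continuous_on_compose2[OF cont]) (auto intro: continuous_intros)
    from linear_mixed_bvp[OF L k this, of c] obtain u u1 where u: "u 0 = c" "u1 L = 0"
      "\<And>x. x \<in> {0..L} \<Longrightarrow> (u has_real_derivative u1 x) (at x within {0..L})"
      "\<And>x. x \<in> {0..L} \<Longrightarrow> (u1 has_real_derivative k\<^sup>2 * u x - (k\<^sup>2 * v x - f (v x))) (at x within {0..L})"
      by blast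
    have cu: "continuous_on {0..L} u" using u(3) DERIV_continuous_on by blast
    have "(\<lambda>x. u (clip x)) \<in> bcontfun"
    proof -
      have "continuous_on UNIV (\<lambda>x. u (clip x))"
        by (rule continuous_on_compose2[OF cu]) (use clip in \<open>auto simp: clip_def intro!: continuous_intros\<close>)
      moreover have "bounded (range (\<lambda>x. u (clip x)))"
        by (rule bounded_subset[OF compact_imp_bounded[OF compact_continuous_image[OF cu compact_Icc]]])
          (use clip in auto)
      ultimately show ?thesis by (simp add: bcontfun_def)
    qed
    then have w: "apply_bcontfun (Bcontfun (\<lambda>x. u (clip x))) = (\<lambda>x. u (clip x))"
      by (simp add: Bcontfun_inverse)
    have "((\<lambda>x. u (clip x)) has_real_derivative u1 x) (at x within {0..L})" if "x \<in> {0..L}" for x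
      using u(3)[OF that] by (rule has_field_derivative_transform_within[where d=1]) (use that clip_id in auto)
    then show ?thesis
      using u L by (intro exI[of _ "Bcontfun (\<lambda>x. u (clip x))"] exI[of _ u1]) (auto simp: w clip_id clip_def[of 0] clip_id[OF clip])
  qed
  then obtain \<Phi> :: "(real \<Rightarrow>\<^sub>C real) \<Rightarrow> (real \<Rightarrow>\<^sub>C real)" and \<Phi>1 where
    \<Phi>: "\<And>v. \<Phi> v 0 = c" "\<And>v. \<Phi>1 v L = 0" "\<And>v x. \<Phi> v x = \<Phi> v (clip x)"
      "\<And>v x. x \<in> {0..L} \<Longrightarrow> (\<Phi> v has_real_derivative \<Phi>1 v x) (at x within {0..L})"
      "\<And>v x. x \<in> {0..L} \<Longrightarrow> (\<Phi>1 v has_real_derivative k\<^sup>2 * \<Phi> v x - (k\<^sup>2 * v x - f (v x))) (at x within {0..L})"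
    by metis
  \<comment> \<open>The largest value, attained at \<open>L\<close>, of the barrier \<open>e\<close>
    below for \<open>D = 1\<close>.\<close>
  define r where "r = 1 - 1 / cosh (k * L)"
  have ch: "cosh (k * L) \<ge> 1" by (rule cosh_real_ge_1)
  have r: "0 \<le> r" "r < 1" using ch by (auto simp: r_def)
  have le: "\<Phi> v x - \<Phi> w x \<le> r * dist v w" if "x \<in> {0..L}" for v w x
  proof -
    define D where "D = dist v w"
    have D0: "0 \<le> D" by (simp add: D_def)
    have Dvw: "\<bar>v y - w y\<bar> \<le> D" for y
      unfolding D_def using dist_bounded[of v y w] by (simp add: dist_real_def)
    \<comment> \<open>The barrier solves \<open>e'' = k\<^sup>2 (e - D)\<close>, \<open>e 0 = 0\<close>, \<open>e' L = 0\<close>.\<close>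
    define e where "e y = D * (1 - cosh (k * (L - y)) / cosh (k * L))" for y
    let ?h = "\<lambda>v y. k\<^sup>2 * v y - f (v y)"
    have "0 \<le> e x - (\<Phi> v x - \<Phi> w x)"
    proof (rule neumann_max_principle[where z = "\<lambda>y. e y - (\<Phi> v y - \<Phi> w y)"
          and dz = "\<lambda>y. D * k * sinh (k * (L - y)) / cosh (k * L) - (\<Phi>1 v y - \<Phi>1 w y)"
          and ddz = "\<lambda>y. - D * k\<^sup>2 * cosh (k * (L - y)) / cosh (k * L)
             - ((k\<^sup>2 * \<Phi> v y - ?h v y) - (k\<^sup>2 * \<Phi> w y - ?h w y))", OF L _ _ _ _ _ that])
      fix y assume y: "y \<in> {0..L}"
      show "((\<lambda>y. e y - (\<Phi> v y - \<Phi> w y)) has_real_derivative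
          D * k * sinh (k * (L - y)) / cosh (k * L) - (\<Phi>1 v y - \<Phi>1 w y)) (at y within {0..L})"
        unfolding e_def by (auto intro!: derivative_eq_intros \<Phi>(4)[OF y])
      show "((\<lambda>y. D * k * sinh (k * (L - y)) / cosh (k * L) - (\<Phi>1 v y - \<Phi>1 w y)) has_real_derivative
         - D * k\<^sup>2 * cosh (k * (L - y)) / cosh (k * L)
             - ((k\<^sup>2 * \<Phi> v y - ?h v y) - (k\<^sup>2 * \<Phi> w y - ?h w y))) (at y within {0..L})"
        by (auto intro!: derivative_eq_intros \<Phi>(5)[OF y] simp: power2_eq_square)
      assume neg: "e y - (\<Phi> v y - \<Phi> w y) < 0"
      have "k\<^sup>2 * e y \<le> k\<^sup>2 * (\<Phi> v y - \<Phi> w y)" using neg by (intro mult_left_mono) auto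
      moreover have "?h v y - ?h w y \<le> k\<^sup>2 * D"
        using lip[of "v y" "w y"] mult_left_mono[OF Dvw[of y], of "k\<^sup>2"] by (simp add: abs_le_iff)
      moreover have "k\<^sup>2 * e y = k\<^sup>2 * D - D * k\<^sup>2 * cosh (k * (L - y)) / cosh (k * L)"
        by (simp add: e_def algebra_simps)
      ultimately show "- D * k\<^sup>2 * cosh (k * (L - y)) / cosh (k * L)
             - ((k\<^sup>2 * \<Phi> v y - ?h v y) - (k\<^sup>2 * \<Phi> w y - ?h w y)) \<le> 0"
        by (simp add: algebra_simps)
    qed (use ch in \<open>auto simp: e_def \<Phi>(1,2)\<close>)
    moreover have "e x \<le> D * r"
      unfolding e_def r_def using D0 ch cosh_real_ge_1[of "k * (L - x)"]
      by (intro mult_left_mono diff_left_mono divide_right_mono) auto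
    ultimately show ?thesis by (simp add: D_def mult.commute)
  qed
  have "dist (\<Phi> v) (\<Phi> w) \<le> r * dist v w" for v w
  proof (rule dist_bound)
    fix x
    have "\<bar>\<Phi> v (clip x) - \<Phi> w (clip x)\<bar> \<le> r * dist v w"
      using le[OF clip, of v x w] le[OF clip, of w x v] by (simp add: abs_le_iff dist_commute)
    then show "dist (\<Phi> v x) (\<Phi> w x) \<le> r * dist v w"
      using \<Phi>(3)[of v x] \<Phi>(3)[of w x] by (simp add: dist_real_def)
  qed
  then obtain v where v: "\<Phi> v = v"
    using banach_fix_type[OF r, of \<Phi>] by blast
  have "mixed_bvp L f c v (\<Phi>1 v)"
    unfolding mixed_bvp_def using \<Phi>(1,2)[of v] \<Phi>(4,5)[of _ v] by (simp add: v)
  then show ?thesis by blast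
qed

section \<open>Comparison, positive solutions and continuous dependence\<close>

lemma mixed_bvpD:
  assumes "mixed_bvp L f c u u1"
  shows "u 0 = c" "u1 L = 0"
    "\<And>x. x \<in> {0..L} \<Longrightarrow> (u has_real_derivative u1 x) (at x within {0..L})"
    "\<And>x. x \<in> {0..L} \<Longrightarrow> (u1 has_real_derivative f (u x)) (at x within {0..L})"
    "continuous_on {0..L} u" "continuous_on {0..L} u1"
  using assms DERIV_continuous_on[of "{0..L}" u u1]
    DERIV_continuous_on[of "{0..L}" u1 "\<lambda>x. f (u x)"]
  unfolding mixed_bvp_def by auto

text \<open>Where \<open>u < v\<close>, monotonicity gives
  \<open>u'' = f u \<le> f v \<le> v''\<close>, so the maximum principle applies to
  \<open>u - v\<close>. The set \<open>S\<close> allows an \<open>f\<close> that is monotone only on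
  the positive axis.\<close>

lemma subsolution_le:
  assumes L: "0 < L" and u: "mixed_bvp L f c u u1" and f: "mono_on S f"
    and S: "\<And>x. x \<in> {0..L} \<Longrightarrow> u x \<in> S \<and> v x \<in> S"
    and v: "\<And>x. x \<in> {0..L} \<Longrightarrow> (v has_real_derivative dv x) (at x within {0..L})"
    and dv: "\<And>x. x \<in> {0..L} \<Longrightarrow> (dv has_real_derivative ddv x) (at x within {0..L})"
    and bd: "v 0 \<le> c" "dv L = 0"
    and sub: "\<And>x. x \<in> {0..L} \<Longrightarrow> f (v x) \<le> ddv x"
    and x: "x \<in> {0..L}"
  shows "v x \<le> u x"
proof -
  note D = mixed_bvpD[OF u]
  have "0 \<le> u x - v x"
  proof (rule neumann_max_principle[where z = "\<lambda>y. u y - v y" and dz = "\<lambda>y. u1 y - dv y"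
        and ddz = "\<lambda>y. f (u y) - ddv y", OF L _ _ _ _ _ x])
    fix y assume y: "y \<in> {0..L}"
    show "((\<lambda>y. u y - v y) has_real_derivative u1 y - dv y) (at y within {0..L})"
      "((\<lambda>y. u1 y - dv y) has_real_derivative f (u y) - ddv y) (at y within {0..L})"
      by (intro DERIV_diff D y v dv)+
    assume "u y - v y < 0"
    then have "f (u y) \<le> f (v y)" using S[OF y] by (intro mono_onD[OF f]) auto
    then show "f (u y) - ddv y \<le> 0" using sub[OF y] by linarith
  qed (use D bd in auto)
  then show ?thesis by simp
qed

lemma le_supersolution:
  assumes L: "0 < L" and u: "mixed_bvp L f c u u1" and f: "mono_on S f"
    and S: "\<And>x. x \<in> {0..L} \<Longrightarrow> u x \<in> S \<and> v x \<in> S"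
    and v: "\<And>x. x \<in> {0..L} \<Longrightarrow> (v has_real_derivative dv x) (at x within {0..L})"
    and dv: "\<And>x. x \<in> {0..L} \<Longrightarrow> (dv has_real_derivative ddv x) (at x within {0..L})"
    and bd: "c \<le> v 0" "dv L = 0"
    and super: "\<And>x. x \<in> {0..L} \<Longrightarrow> ddv x \<le> f (v x)"
    and x: "x \<in> {0..L}"
  shows "u x \<le> v x"
proof -
  note D = mixed_bvpD[OF u]
  have "0 \<le> v x - u x"
  proof (rule neumann_max_principle[where z = "\<lambda>y. v y - u y" and dz = "\<lambda>y. dv y - u1 y"
        and ddz = "\<lambda>y. ddv y - f (u y)", OF L _ _ _ _ _ x])
    fix y assume y: "y \<in> {0..L}"
    show "((\<lambda>y. v y - u y) has_real_derivative dv y - u1 y) (at y within {0..L})"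
      "((\<lambda>y. dv y - u1 y) has_real_derivative ddv y - f (u y)) (at y within {0..L})"
      by (intro DERIV_diff D y v dv)+
    assume "v y - u y < 0"
    then have "f (v y) \<le> f (u y)" using S[OF y] by (intro mono_onD[OF f]) auto
    then show "ddv y - f (u y) \<le> 0" using super[OF y] by linarith
  qed (use D bd in auto)
  then show ?thesis by simp
qed

text \<open>Since \<open>f\<close> may be singular at \<open>0\<close>, its argument is truncated to
  \<open>{a..b}\<close>. The constant \<open>b\<close> is a supersolution, and
  \<open>a * cosh (k * (L - x))\<close>, with value \<open>c\<close> at \<open>0\<close> and minimum
  \<open>a\<close> at \<open>L\<close>, is a subsolution by the linear bound on \<open>f\<close>. So
  the solution stays in \<open>{a..b}\<close>, where the truncation is inactive.\<close>

lemma positive_mixed_bvp: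
  assumes L: "0 < L" and c: "0 < c" and f: "mono_on {0<..} f"
    and lip: "\<And>a b. 0 < a \<Longrightarrow> a \<le> b \<Longrightarrow> \<exists>K>0. \<forall>s t. a \<le> s \<and> s \<le> t \<and> t \<le> b \<longrightarrow> f t - f s \<le> K * (t - s)"
    and b: "c \<le> b" "0 \<le> f b"
    and k: "\<And>s. 0 < s \<Longrightarrow> s \<le> c \<Longrightarrow> f s \<le> k\<^sup>2 * s"
  shows "\<exists>u u1. mixed_bvp L f c u u1 \<and> (\<forall>x\<in>{0..L}. 0 < u x)"
proof -
  have ch: "cosh (k * y) \<ge> 1" for y by (rule cosh_real_ge_1)
  have ch0: "cosh (k * y) > 0" for y using ch[of y] by linarith
  define a where "a = c / cosh (k * L)"
  have a: "0 < a" "a \<le> c"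
    using c ch[of L] by (auto simp: a_def divide_le_eq)
  obtain K where K: "0 < K" "\<And>s t. a \<le> s \<Longrightarrow> s \<le> t \<Longrightarrow> t \<le> b \<Longrightarrow> f t - f s \<le> K * (t - s)"
    using lip[of a b] a b by fastforce
  define g where "g x = f (max a (min b x))" for x
  have mono: "g s \<le> g t" if "s \<le> t" for s t
    unfolding g_def using that a b by (intro mono_onD[OF f]) auto
  have "g t - g s \<le> K * (t - s)" if "s \<le> t" for s t
  proof -
    have "g t - g s \<le> K * (max a (min b t) - max a (min b s))"
      unfolding g_def using that a b by (intro K) auto
    also have "\<dots> \<le> K * (t - s)" using that K(1) by (intro mult_left_mono) auto
    finally show ?thesis .
  qed
  then obtain u u1 where u: "mixed_bvp L g c u u1"
    using lipschitz_mixed_bvp[OF L, of "sqrt K" g c] mono K(1) by auto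
  have mg: "mono_on UNIV g" using mono by (simp add: mono_on_def)
  have ub: "u x \<le> b" if "x \<in> {0..L}" for x
    by (rule le_supersolution[OF L u mg _ _ _ _ _ _ that, where dv = "\<lambda>_. 0" and ddv = "\<lambda>_. 0"])
      (use b a in \<open>auto simp: g_def intro!: derivative_eq_intros\<close>)
  have lb: "a \<le> u x" if x: "x \<in> {0..L}" for x
  proof -
    let ?v = "\<lambda>x. a * cosh (k * (L - x))"
    have "a \<le> ?v x" using ch[of "L - x"] a by simp
    also have "?v x \<le> u x"
    proof (rule subsolution_le[OF L u mg _ _ _ _ _ _ x, where dv = "\<lambda>x. - a * k * sinh (k * (L - x))"
          and ddv = "\<lambda>x. k\<^sup>2 * ?v x"])
      fix y assume y: "y \<in> {0..L}"
      have "cosh (k * (L - y)) \<le> cosh (k * L)"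
      proof -
        have "cosh \<bar>k * (L - y)\<bar> \<le> cosh \<bar>k * L\<bar>"
          using y L by (subst cosh_real_nonneg_le_iff) (auto simp: abs_mult intro!: mult_left_mono)
        then show ?thesis by simp
      qed
      then have "?v y \<le> c"
        using a c ch0[of L] by (simp add: a_def field_simps)
      moreover have "a \<le> ?v y" using ch[of "L - y"] a by simp
      ultimately show "g (?v y) \<le> k\<^sup>2 * ?v y"
        using k[of "?v y"] a b by (simp add: g_def)
    qed (use ch0[of L] in \<open>auto simp: a_def power2_eq_square intro!: derivative_eq_intros\<close>)
    finally show ?thesis .
  qed
  have "g (u x) = f (u x)" if "x \<in> {0..L}" for x
    using ub[OF that] lb[OF that] by (simp add: g_def)
  then have "mixed_bvp L f c u u1"
    using u unfolding mixed_bvp_def by simp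
  then show ?thesis using lb a(1) by fastforce
qed

text \<open>The barrier \<open>e\<close> satisfies \<open>e'' = - d\<close>, \<open>e 0 = d\<close>
  and has zero slope at \<open>L\<close>; the maximum principle bounds both signs of
  \<open>u - u'\<close> by it. The perturbation of the nonlinearity is measured only along
  \<open>u'\<close>, which is the fixed limit solution in the application.\<close>

lemma mixed_bvp_stability:
  assumes L: "0 < L" and u: "mixed_bvp L f c u u1" and u': "mixed_bvp L f' c' u' u1'"
    and f: "mono_on S f" and S: "\<And>x. x \<in> {0..L} \<Longrightarrow> u x \<in> S \<and> u' x \<in> S"
    and c: "\<bar>c - c'\<bar> \<le> d" and d: "\<And>x. x \<in> {0..L} \<Longrightarrow> \<bar>f (u' x) - f' (u' x)\<bar> \<le> d"
    and x: "x \<in> {0..L}"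
  shows "\<bar>u x - u' x\<bar> \<le> d * (1 + L\<^sup>2)"
proof -
  note D = mixed_bvpD[OF u] and D' = mixed_bvpD[OF u']
  have d0: "0 \<le> d" using c by linarith
  define e where "e y = d * (1 + L * y - y\<^sup>2 / 2)" for y
  define e1 where "e1 y = d * (L - y)" for y
  have e: "(e has_real_derivative e1 y) (at y within {0..L})"
    and e1: "(e1 has_real_derivative - d) (at y within {0..L})" for y
    unfolding e_def e1_def by (auto intro!: derivative_eq_intros)
  have e0: "0 \<le> e y" and eL: "e y \<le> d * (1 + L\<^sup>2)" if "y \<in> {0..L}" for y
  proof -
    have "y\<^sup>2 \<le> L * y" "L * y \<le> L\<^sup>2" "0 \<le> y\<^sup>2"
      using that by (auto simp: power2_eq_square mult_right_mono mult_left_mono)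
    then have "0 \<le> 1 + L * y - y\<^sup>2 / 2" "1 + L * y - y\<^sup>2 / 2 \<le> 1 + L\<^sup>2" by linarith+
    then show "0 \<le> e y" "e y \<le> d * (1 + L\<^sup>2)"
      unfolding e_def using d0 by (auto intro!: mult_nonneg_nonneg mult_left_mono)
  qed
  have "0 \<le> e x - (u x - u' x)"
  proof (rule neumann_max_principle[where z = "\<lambda>y. e y - (u y - u' y)" and dz = "\<lambda>y. e1 y - (u1 y - u1' y)"
        and ddz = "\<lambda>y. - d - (f (u y) - f' (u' y))", OF L _ _ _ _ _ x])
    fix y assume y: "y \<in> {0..L}"
    show "((\<lambda>y. e y - (u y - u' y)) has_real_derivative e1 y - (u1 y - u1' y)) (at y within {0..L})"
      "((\<lambda>y. e1 y - (u1 y - u1' y)) has_real_derivative - d - (f (u y) - f' (u' y))) (at y within {0..L})"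
      by (intro DERIV_diff D D' y e e1)+
    assume "e y - (u y - u' y) < 0"
    then have "f (u' y) \<le> f (u y)" using S[OF y] e0[OF y] by (intro mono_onD[OF f]) auto
    then show "- d - (f (u y) - f' (u' y)) \<le> 0" using d[OF y] by linarith
  qed (use D D' c in \<open>auto simp: e_def e1_def\<close>)
  moreover have "0 \<le> e x - (u' x - u x)"
  proof (rule neumann_max_principle[where z = "\<lambda>y. e y - (u' y - u y)" and dz = "\<lambda>y. e1 y - (u1' y - u1 y)"
        and ddz = "\<lambda>y. - d - (f' (u' y) - f (u y))", OF L _ _ _ _ _ x])
    fix y assume y: "y \<in> {0..L}"
    show "((\<lambda>y. e y - (u' y - u y)) has_real_derivative e1 y - (u1' y - u1 y)) (at y within {0..L})"
      "((\<lambda>y. e1 y - (u1' y - u1 y)) has_real_derivative - d - (f' (u' y) - f (u y))) (at y within {0..L})"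
      by (intro DERIV_diff D D' y e e1)+
    assume "e y - (u' y - u y) < 0"
    then have "f (u y) \<le> f (u' y)" using S[OF y] e0[OF y] by (intro mono_onD[OF f]) auto
    then show "- d - (f' (u' y) - f (u y)) \<le> 0" using d[OF y] by linarith
  qed (use D D' c in \<open>auto simp: e_def e1_def\<close>)
  ultimately show ?thesis using eL[OF x] by linarith
qed

text \<open>All slopes vanish at \<open>L\<close>, so the difference of the slopes at
  \<open>0\<close> is at most \<open>L\<close> times the supremum of the difference of the second
  derivatives. Stability makes \<open>u i\<close> uniformly close to \<open>v\<close>, and uniform
  continuity of \<open>g\<close> does the rest.\<close>

lemma tendsto_initial_slope:
  fixes f :: "'i \<Rightarrow> real \<Rightarrow> real"
  assumes L: "0 < L"
    and u: "\<And>i. mixed_bvp L (f i) (c i) (u i) (u1 i)" "\<And>i x. x \<in> {0..L} \<Longrightarrow> 0 < u i x"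
    and v: "mixed_bvp L g d v v1" "\<And>x. x \<in> {0..L} \<Longrightarrow> 0 < v x"
    and f: "\<And>i. mono_on {0<..} (f i)" and g: "continuous_on {0<..} g"
    and c: "(c \<longlongrightarrow> d) F"
    and lim: "\<And>a b. 0 < a \<Longrightarrow> uniform_limit {a..b} f g F"
  shows "((\<lambda>i. u1 i 0) \<longlongrightarrow> v1 0) F"
proof (rule tendstoI)
  fix \<epsilon>' :: real assume "0 < \<epsilon>'"
  define \<epsilon> where "\<epsilon> = \<epsilon>' / (3 * L)"
  have \<epsilon>: "0 < \<epsilon>" using \<open>0 < \<epsilon>'\<close> L by (simp add: \<epsilon>_def)
  note V = mixed_bvpD[OF v(1)]
  obtain xm where xm: "xm \<in> {0..L}" "\<And>y. y \<in> {0..L} \<Longrightarrow> v xm \<le> v y"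
    using continuous_attains_inf[OF _ _ V(5)] L by fastforce
  obtain xM where xM: "xM \<in> {0..L}" "\<And>y. y \<in> {0..L} \<Longrightarrow> v y \<le> v xM"
    using continuous_attains_sup[OF _ _ V(5)] L by fastforce
  define m M where "m = v xm" and "M = v xM"
  have m: "0 < m" "m \<le> M" and vb: "\<And>y. y \<in> {0..L} \<Longrightarrow> m \<le> v y \<and> v y \<le> M"
    using v(2)[OF xm(1)] xm xM unfolding m_def M_def by auto
  have "uniformly_continuous_on {m/2..M+1} g"
    by (rule compact_uniformly_continuous[OF continuous_on_subset[OF g]]) (use m in auto)
  then obtain \<eta> where \<eta>: "0 < \<eta>"
    "\<And>s t. s \<in> {m/2..M+1} \<Longrightarrow> t \<in> {m/2..M+1} \<Longrightarrow> dist s t < \<eta> \<Longrightarrow> dist (g s) (g t) < \<epsilon>"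
    unfolding uniformly_continuous_on_def using \<epsilon> by metis
  \<comment> \<open>Being \<open>\<rho>\<close>-close to \<open>v\<close> keeps \<open>u i\<close>
    inside \<open>{m/2..M+1}\<close>, away from the singularity, and within the modulus of
    continuity \<open>\<eta>\<close>.\<close>
  define \<rho> where "\<rho> = min (\<eta> / 2) (min (m / 2) 1)"
  have \<rho>: "0 < \<rho>" "\<rho> < \<eta>" "\<rho> \<le> m / 2" "\<rho> \<le> 1" using \<eta>(1) m by (auto simp: \<rho>_def)
  define \<delta> where "\<delta> = \<rho> / (1 + L\<^sup>2)"
  have L2: "1 + L\<^sup>2 > 0" by (smt (verit) zero_le_power2)
  have \<delta>: "0 < \<delta>" "\<delta> * (1 + L\<^sup>2) = \<rho>" using \<rho> L2 by (auto simp: \<delta>_def)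
  have "\<forall>\<^sub>F i in F. \<forall>s\<in>{m/2..M+1}. dist (f i s) (g s) < min \<epsilon> \<delta>"
    using lim[of "m/2" "M+1"] m \<epsilon> \<delta> by (intro uniform_limitD) auto
  moreover have "\<forall>\<^sub>F i in F. dist (c i) d < \<delta>" using c \<delta> by (intro tendstoD) auto
  ultimately show "\<forall>\<^sub>F i in F. dist (u1 i 0) (v1 0) < \<epsilon>'"
  proof eventually_elim
    case (elim i)
    note U = mixed_bvpD[OF u(1)[of i]]
    have close: "\<bar>u i x - v x\<bar> \<le> \<rho>" if "x \<in> {0..L}" for x
      unfolding \<delta>(2)[symmetric]
    proof (rule mixed_bvp_stability[OF L u(1) v(1) f _ _ _ that])
      show "\<bar>f i (v y) - g (v y)\<bar> \<le> \<delta>" if "y \<in> {0..L}" for y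
        using bspec[OF elim(1), of "v y"] vb[OF that] m by (auto simp: dist_real_def)
    qed (use elim(2) u(2) v(2) in \<open>auto simp: dist_real_def\<close>)
    have "norm ((u1 i 0 - v1 0) - (u1 i L - v1 L)) \<le> (2 * \<epsilon>) * norm (0 - L)"
    proof (rule field_differentiable_bound[of "{0..L}" "\<lambda>x. u1 i x - v1 x" "\<lambda>x. f i (u i x) - g (v x)"])
      fix x assume x: "x \<in> {0..L}"
      show "((\<lambda>x. u1 i x - v1 x) has_real_derivative f i (u i x) - g (v x)) (at x within {0..L})"
        by (intro DERIV_diff U V x)
      have "u i x \<in> {m/2..M+1}" "v x \<in> {m/2..M+1}" and uv: "dist (u i x) (v x) < \<eta>"
        using close[OF x] vb[OF x] \<rho> m by (auto simp: abs_le_iff dist_real_def)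
      then have "dist (f i (u i x)) (g (u i x)) < \<epsilon>" "dist (g (u i x)) (g (v x)) < \<epsilon>"
        using elim(1) \<eta>(2) by auto
      then show "norm (f i (u i x) - g (v x)) \<le> 2 * \<epsilon>" by (simp add: dist_real_def)
    qed (use L in auto)
    then have "dist (u1 i 0) (v1 0) \<le> 2 * \<epsilon> * L"
      using L U(2) V(2) by (simp add: dist_real_def)
    also have "\<dots> < \<epsilon>'" using L \<open>0 < \<epsilon>'\<close> by (simp add: \<epsilon>_def)
    finally show ?case .
  qed
qed

section \<open>The Lichnerowicz nonlinearity with constant coefficients\<close>

text \<open>The first equation reads \<open>\<phi>'' = lich q T A \<phi>\<close> on each half circle, with \<open>T = \<bar>t \<plusminus> 1\<bar>\<close> and
  \<open>A = 2 \<eta>\<^sup>2 / \<kappa> + (\<mu> + \<phi>(0)\<^sup>q (g \<plusminus> 1))\<^sup>2\<close>.\<close>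

definition lich :: "real \<Rightarrow> real \<Rightarrow> real \<Rightarrow> real \<Rightarrow> real" where
  "lich q T A s = (T\<^sup>2 * s powr (q - 1) - A * s powr (- q - 1)) / (2 * q)"

lemma lich_factored:
  assumes "0 < s"
  shows "lich q T A s = ((T * s powr q)\<^sup>2 - A) / (2 * q * (s * s powr q))"
proof -
  have "s powr (q - 1) = s powr q / s" "s powr (- q - 1) = 1 / (s * s powr q)"
    using assms by (simp_all add: powr_diff powr_minus field_simps)
  then show ?thesis
    unfolding lich_def using assms by (simp only:) (simp add: field_simps power2_eq_square)
qed

lemma lich_sign:
  assumes "0 < s" "0 < q"
  shows "0 \<le> lich q T A s \<longleftrightarrow> A \<le> (T * s powr q)\<^sup>2" "lich q T A s \<le> 0 \<longleftrightarrow> (T * s powr q)\<^sup>2 \<le> A"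
  using assms by (simp_all add: lich_factored zero_le_divide_iff divide_le_0_iff mult_le_0_iff not_le[symmetric])

lemma DERIV_lich:
  assumes "0 < s" "0 < q"
  shows "(lich q T A has_real_derivative
    (T\<^sup>2 * (q - 1) * s powr (q - 2) + A * (q + 1) * s powr (- q - 2)) / (2 * q)) (at s within S)"
  unfolding lich_def using assms
  by (auto intro!: derivative_eq_intros simp: field_simps)

lemma continuous_on_lich: "0 < q \<Longrightarrow> continuous_on {0<..} (lich q T A)"
  using DERIV_lich by (intro DERIV_continuous_on) auto

lemma mono_on_lich:
  assumes "0 < q" "1 \<le> q" "0 \<le> A"
  shows "mono_on {0<..} (lich q T A)"
proof (rule mono_onI)
  fix r s :: real assume "r \<in> {0<..}" "s \<in> {0<..}" "r \<le> s"
  then have "r powr (q - 1) \<le> s powr (q - 1)" "s powr (- q - 1) \<le> r powr (- q - 1)"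
    using assms by (auto intro: powr_mono2 powr_mono2')
  then show "lich q T A r \<le> lich q T A s"
    unfolding lich_def using assms by (intro divide_right_mono diff_mono mult_left_mono) auto
qed

lemma lich_lipschitz:
  assumes q: "2 < q" and A: "0 \<le> A" and T: "0 < T" and a: "0 < a" "a \<le> b"
  shows "\<exists>K>0. \<forall>s t. a \<le> s \<and> s \<le> t \<and> t \<le> b \<longrightarrow> lich q T A t - lich q T A s \<le> K * (t - s)"
proof -
  \<comment> \<open>A bound for the derivative on \<open>{a..b}\<close>: its first term is largest
    at \<open>b\<close>, since \<open>q > 2\<close>, and its second at \<open>a\<close>.\<close>
  define K where "K = (T\<^sup>2 * (q - 1) * b powr (q - 2) + A * (q + 1) * a powr (- q - 2)) / (2 * q)"
  have "0 < K"
    unfolding K_def using q A T a by (intro divide_pos_pos add_pos_nonneg mult_pos_pos mult_nonneg_nonneg) auto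
  moreover have "lich q T A t - lich q T A s \<le> K * (t - s)" if "a \<le> s" "s \<le> t" "t \<le> b" for s t
  proof -
    have "norm (lich q T A t - lich q T A s) \<le> K * norm (t - s)"
    proof (rule field_differentiable_bound[of "{a..b}"])
      fix y assume y: "y \<in> {a..b}"
      let ?d = "(T\<^sup>2 * (q - 1) * y powr (q - 2) + A * (q + 1) * y powr (- q - 2)) / (2 * q)"
      show "(lich q T A has_real_derivative ?d) (at y within {a..b})"
        using y a q by (intro DERIV_lich) auto
      have "y powr (q - 2) \<le> b powr (q - 2)" "y powr (- q - 2) \<le> a powr (- q - 2)"
        using y a q by (auto intro: powr_mono2 powr_mono2')
      then have "?d \<le> K"
        unfolding K_def using q A by (intro divide_right_mono add_mono mult_left_mono) auto
      moreover have "0 \<le> ?d" using q A by (auto intro!: divide_nonneg_nonneg add_nonneg_nonneg)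
      ultimately show "norm ?d \<le> K" by simp
    qed (use that in auto)
    then show ?thesis using that by simp
  qed
  ultimately show ?thesis by blast
qed

lemma uniform_limit_lich:
  assumes "(A \<longlongrightarrow> B) F" "0 < a" "0 < q"
  shows "uniform_limit {a..b} (\<lambda>i. lich q T (A i)) (lich q T B) F"
proof (rule uniform_limitI)
  fix e :: real assume "0 < e"
  define C where "C = a powr (- q - 1) / (2 * q)"
  have C: "0 < C" using assms by (simp add: C_def)
  have "\<forall>\<^sub>F i in F. dist (A i) B < e / C"
    using assms(1) \<open>0 < e\<close> C by (intro tendstoD) auto
  then show "\<forall>\<^sub>F i in F. \<forall>s\<in>{a..b}. dist (lich q T (A i) s) (lich q T B s) < e"
  proof eventually_elim
    case (elim i)
    show ?case
    proof
      fix s assume s: "s \<in> {a..b}"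
      have "lich q T (A i) s - lich q T B s = (B - A i) * (s powr (- q - 1) / (2 * q))"
        by (simp add: lich_def algebra_simps diff_divide_distrib add_divide_distrib)
      then have "dist (lich q T (A i) s) (lich q T B s) = dist (A i) B * (s powr (- q - 1) / (2 * q))"
        using assms(3) by (simp add: dist_real_def abs_mult abs_minus_commute)
      also have "\<dots> \<le> dist (A i) B * C"
        unfolding C_def using s assms by (intro mult_left_mono divide_right_mono powr_mono2') auto
      also have "\<dots> < e" using elim C by (simp add: field_simps)
      finally show "dist (lich q T (A i) s) (lich q T B s) < e" .
    qed
  qed
qed

section \<open>Existence, energy and slope bounds relative to the constant equilibrium\<close>

lemma lich_equilibrium:
  assumes "0 < T" "0 \<le> A" "0 < q"
  shows "T * (((sqrt A) / T) powr (1 / q)) powr q = sqrt A"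
  using assms by (simp add: powr_powr)

text \<open>The larger of \<open>c\<close> and the equilibrium is the upper barrier; the maximum
  also covers \<open>A = 0\<close>, where the equilibrium is \<open>0\<close>. For the linear bound
  drop the \<open>A\<close> term and use that \<open>s powr (q - 2)\<close> is increasing.\<close>

lemma lich_bvp_exists:
  assumes L: "0 < L" and c: "0 < c" and q: "2 < q" and T: "0 < T" and A: "0 \<le> A"
  shows "\<exists>u u1. mixed_bvp L (lich q T A) c u u1 \<and> (\<forall>x\<in>{0..L}. 0 < u x)"
proof -
  define e where "e = (sqrt A / T) powr (1 / q)"
  have "(T * e powr q)\<^sup>2 = A"
    using lich_equilibrium[of T A q] T A q by (simp add: e_def)
  moreover have "(T * e powr q)\<^sup>2 \<le> (T * (max c e) powr q)\<^sup>2"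
    using T q by (intro power_mono mult_left_mono powr_mono2) (auto simp: e_def)
  ultimately have b: "0 \<le> lich q T A (max c e)"
    using c q by (subst lich_sign) auto
  define k where "k = sqrt (T\<^sup>2 * c powr (q - 2) / (2 * q))"
  have k: "k\<^sup>2 = T\<^sup>2 * c powr (q - 2) / (2 * q)" using q by (simp add: k_def)
  show ?thesis
  proof (rule positive_mixed_bvp[OF L c])
    fix s assume s: "0 < s" "s \<le> c"
    have "lich q T A s \<le> T\<^sup>2 * s powr (q - 1) / (2 * q)"
      unfolding lich_def using A q by (intro divide_right_mono) auto
    also have "s powr (q - 1) = s powr (q - 2) * s"
      using s powr_add[of s "q - 2" 1] by simp
    also have "T\<^sup>2 * (s powr (q - 2) * s) / (2 * q) = (T\<^sup>2 * s powr (q - 2) / (2 * q)) * s" by simp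
    also have "\<dots> \<le> k\<^sup>2 * s"
      unfolding k using s q by (intro mult_right_mono divide_right_mono mult_left_mono powr_mono2) auto
    finally show "lich q T A s \<le> k\<^sup>2 * s" .
  qed (use b q A T mono_on_lich lich_lipschitz in auto)
qed

lemma DERIV_within_nonneg_mono:
  fixes f :: "real \<Rightarrow> real"
  assumes "\<And>x. x \<in> {a..b} \<Longrightarrow> (f has_real_derivative f' x) (at x within {a..b})"
    and "\<And>x. x \<in> {a..b} \<Longrightarrow> 0 \<le> f' x" and "a \<le> x" "x \<le> y" "y \<le> b"
  shows "f x \<le> f y"
proof (rule DERIV_nonneg_imp_increasing_open[where f = f])
  fix s assume "x < s" "s < y"
  then show "\<exists>d. DERIV f s :> d \<and> 0 \<le> d"
    using assms(1,2)[of s] assms(3-5) at_within_Icc_at[of a s b] by auto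
next
  show "continuous_on {x..y} f"
    by (rule continuous_on_subset[OF DERIV_continuous_on[OF assms(1)]]) (use assms(3-5) in auto)
qed (use assms in auto)

lemma DERIV_within_nonpos_antimono:
  fixes f :: "real \<Rightarrow> real"
  assumes "\<And>x. x \<in> {a..b} \<Longrightarrow> (f has_real_derivative f' x) (at x within {a..b})"
    and "\<And>x. x \<in> {a..b} \<Longrightarrow> f' x \<le> 0" and "a \<le> x" "x \<le> y" "y \<le> b"
  shows "f y \<le> f x"
  using DERIV_within_nonneg_mono[of a b "\<lambda>x. - f x" "\<lambda>x. - f' x" x y] assms
  by (auto intro: DERIV_minus)

text \<open>A start below the equilibrium \<open>e\<close> keeps the solution below it, so
  \<open>u'' \<le> 0\<close> and the slope decreases to its value \<open>0\<close> at
  \<open>L\<close>.\<close>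

lemma lich_below_equilibrium:
  assumes L: "0 < L" and c: "0 < c" and q: "2 < q" and T: "0 < T" and A: "0 \<le> A"
    and u: "mixed_bvp L (lich q T A) c u u1" "\<And>x. x \<in> {0..L} \<Longrightarrow> 0 < u x"
    and le: "(T * c powr q)\<^sup>2 \<le> A"
  shows "0 \<le> u1 0"
proof -
  note U = mixed_bvpD[OF u(1)]
  have A0: "0 < A" using le T c by (smt (verit) zero_less_power mult_pos_pos powr_gt_zero)
  define e where "e = (sqrt A / T) powr (1 / q)"
  have e0: "0 < e" using A0 T by (simp add: e_def)
  have e: "T * e powr q = sqrt A"
    using lich_equilibrium[of T A q] T A q by (simp add: e_def)
  have e': "lich q T A e = 0"
    using e0 q A by (simp add: lich_factored e)
  have "T * c powr q \<le> sqrt A" using le by (simp add: real_le_rsqrt)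
  then have "c powr q \<le> e powr q" using T by (simp flip: e)
  then have ce: "c \<le> e" using c q e0 by (meson linorder_not_le powr_less_mono2 less_imp_le order_less_trans zero_less_numeral)
  note m = mono_on_lich[of q A T]
  have "u x \<le> e" if "x \<in> {0..L}" for x
    by (rule le_supersolution[OF L u(1) m _ _ _ _ _ _ that, where dv = "\<lambda>_. 0" and ddv = "\<lambda>_. 0"])
      (use ce e' e0 u(2) q A in \<open>auto intro!: derivative_eq_intros\<close>)
  then have "lich q T A (u x) \<le> 0" if "x \<in> {0..L}" for x
    using mono_onD[OF m, of "u x" e] that u(2)[OF that] e0 q A e' by auto
  from DERIV_within_nonpos_antimono[OF U(4) this, of 0 L] L U(2) show ?thesis by simp
qed

text \<open>First integral of the autonomous equation: the \<open>u\<close>-derivative of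
  \<open>A * u powr (- q) + T\<^sup>2 * u powr q\<close> is
  \<open>2 * q\<^sup>2 * lich q T A u\<close>. The kinetic term vanishes at
  \<open>L\<close>.\<close>

lemma lich_energy:
  assumes L: "0 < L" and q: "2 < q"
    and u: "mixed_bvp L (lich q T A) c u u1" "\<And>x. x \<in> {0..L} \<Longrightarrow> 0 < u x"
  shows "q\<^sup>2 * (u1 0)\<^sup>2 = A * c powr (- q) + T\<^sup>2 * c powr q - (A * u L powr (- q) + T\<^sup>2 * u L powr q)"
proof -
  note U = mixed_bvpD[OF u(1)]
  define H where "H x = q\<^sup>2 * (u1 x)\<^sup>2 - (A * u x powr (- q) + T\<^sup>2 * u x powr q)" for x
  have H: "(H has_real_derivative 0) (at x within {0..L})" if x: "x \<in> {0..L}" for x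
  proof -
    have "(H has_real_derivative q\<^sup>2 * (2 * u1 x * lich q T A (u x))
       - (A * (- q * u x powr (- q - 1) * u1 x) + T\<^sup>2 * (q * u x powr (q - 1) * u1 x))) (at x within {0..L})"
      unfolding H_def using u(2)[OF x]
      by (auto intro!: derivative_eq_intros U x)
    moreover have "q\<^sup>2 * (2 * u1 x * lich q T A (u x))
       - (A * (- q * u x powr (- q - 1) * u1 x) + T\<^sup>2 * (q * u x powr (q - 1) * u1 x)) = 0"
      using q by (simp add: lich_def field_simps power2_eq_square)
    ultimately show ?thesis by simp
  qed
  have "H 0 \<le> H L" "H L \<le> H 0"
    using DERIV_within_nonneg_mono[OF H, of 0 L] DERIV_within_nonpos_antimono[OF H, of 0 L] L by auto
  then show ?thesis using U(1,2) by (simp add: H_def)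
qed

text \<open>In terms of \<open>Y\<close>, \<open>M\<close> and \<open>a\<close> the energy is a
  difference of squares. Below the equilibrium, dropping the subtracted term suffices. Above it the
  solution decreases, and for large \<open>c\<close> it has come so close to the equilibrium at
  \<open>L\<close> that the subtracted term is at most \<open>(T * \<epsilon> * Y)\<^sup>2\<close>;
  this forces a steep descent at \<open>0\<close>.\<close>

lemma lich_slope_upper:
  assumes L: "0 < L" and c: "0 < c" and q: "2 < q" and T: "0 < T" and A: "0 \<le> A"
    and u: "mixed_bvp L (lich q T A) c u u1" "\<And>x. x \<in> {0..L} \<Longrightarrow> 0 < u x"
    and \<epsilon>: "0 < \<epsilon>" and large: "4 * q \<le> L\<^sup>2 * T\<^sup>2 * \<epsilon>\<^sup>2 * c powr (q - 2)"
  shows "q * c powr (q / 2) * u1 0 \<le> sqrt A - T * c powr q + T * \<epsilon> * c powr q"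
proof -
  note U = mixed_bvpD[OF u(1)]
  define Y M a where "Y = c powr q" and "M = u L powr q" and "a = sqrt A"
  have Y: "0 < Y" using c by (simp add: Y_def)
  have uL: "0 < u L" using u(2) L by simp
  then have M: "0 < M" by (simp add: M_def)
  have a: "0 \<le> a" "A = a\<^sup>2" using A by (auto simp: a_def)
  have half: "(c powr (q / 2))\<^sup>2 = Y"
    using c by (simp add: Y_def power2_eq_square flip: powr_add)
  have energy: "(q * c powr (q / 2) * u1 0)\<^sup>2 = (T * Y - a)\<^sup>2 - Y * ((T * M - a)\<^sup>2 / M)"
  proof -
    have "(q * c powr (q / 2) * u1 0)\<^sup>2 = Y * (q\<^sup>2 * (u1 0)\<^sup>2)"
      by (simp add: power_mult_distrib half)
    also have "\<dots> = Y * (A / Y + T\<^sup>2 * Y - (A / M + T\<^sup>2 * M))"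
      using lich_energy[OF L q u] by (simp add: Y_def M_def powr_minus divide_inverse)
    also have "\<dots> = (T * Y - a)\<^sup>2 - Y * ((T * M - a)\<^sup>2 / M)"
      using Y M by (simp add: a(2) field_simps power2_eq_square)
    finally show ?thesis .
  qed
  show ?thesis
  proof (cases "T * Y \<le> a")
    case True
    have "(q * c powr (q / 2) * u1 0)\<^sup>2 \<le> (a - T * Y)\<^sup>2"
      using Y M by (simp add: energy power2_commute)
    then have "q * c powr (q / 2) * u1 0 \<le> a - T * Y"
      using True by (auto intro: power2_le_imp_le)
    moreover have "0 \<le> T * \<epsilon> * Y" using T \<epsilon> Y by simp
    ultimately show ?thesis by (simp add: Y_def a_def)
  next
    case False
    \<comment> \<open>The solution stays above the equilibrium, which is a constant subsolution. For
      \<open>A = 0\<close> the equilibrium is not positive, but then \<open>a = 0\<close>.\<close>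
    have Tu: "a \<le> T * u x powr q" if x: "x \<in> {0..L}" for x
    proof (cases "A = 0")
      case True
      then show ?thesis using T by (simp add: a_def)
    next
      case F: False
      define e where "e = (sqrt A / T) powr (1 / q)"
      have e0: "0 < e" using F A T by (simp add: e_def)
      have e: "T * e powr q = a"
        using lich_equilibrium[of T A q] T A q by (simp add: e_def a_def)
      have e': "lich q T A e = 0"
        using e0 q a by (simp add: lich_factored e)
      have "e powr q < c powr q" using False T by (simp add: Y_def flip: e)
      then have ce: "e \<le> c" using c q e0
        by (metis linorder_not_le powr_less_mono2 less_imp_le order_less_trans zero_less_numeral order_less_asym)
      have "e \<le> u x"
        by (rule subsolution_le[OF L u(1) mono_on_lich _ _ _ _ _ _ x, where dv = "\<lambda>_. 0" and ddv = "\<lambda>_. 0"])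
          (use ce e' e0 u(2) q A in \<open>auto intro!: derivative_eq_intros\<close>)
      then have "T * e powr q \<le> T * u x powr q"
        using T e0 q by (intro mult_left_mono powr_mono2) auto
      then show ?thesis by (simp add: e)
    qed
    have pos: "0 \<le> lich q T A (u x)" if "x \<in> {0..L}" for x
      using Tu[OF that] u(2)[OF that] q a by (subst lich_sign) (auto intro!: power_mono)
    have u1: "u1 x \<le> 0" if "x \<in> {0..L}" for x
      using DERIV_within_nonneg_mono[OF U(4) pos, of x L] U(2) that by auto
    have uc: "u x \<le> c" and uM: "u L \<le> u x" if "x \<in> {0..L}" for x
      using DERIV_within_nonpos_antimono[OF U(3) u1, of 0 x]
        DERIV_within_nonpos_antimono[OF U(3) u1, of x L] U(1) that by auto
    have TM: "a \<le> T * M" using Tu[of L] L by (simp add: M_def)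
    \<comment> \<open>Otherwise \<open>u'' \<ge> B\<close> throughout, so that \<open>c = u 0 > B L\<^sup>2 / 2\<close>, against the size of \<open>c\<close>.\<close>
    have close: "T * M - a \<le> T * \<epsilon>\<^sup>2 * Y"
    proof (rule ccontr)
      assume far: "\<not> T * M - a \<le> T * \<epsilon>\<^sup>2 * Y"
      define B where "B = T\<^sup>2 * \<epsilon>\<^sup>2 * Y / (2 * q * c)"
      \<comment> \<open>Factor the numerator of \<open>lich\<close> as
        \<open>(T * V - a) * (T * V + a)\<close>: the first factor is bounded below by
        \<open>far\<close>, the second divided by \<open>V\<close> is at least \<open>T\<close>, and
        \<open>u x \<le> c\<close>.\<close>
      have B: "B \<le> lich q T A (u x)" if x: "x \<in> {0..L}" for x
      proof -
        define V where "V = u x powr q"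
        have V: "0 < V" using u(2)[OF x] by (simp add: V_def)
        have MV: "M \<le> V" unfolding M_def V_def using uM[OF x] uL q by (intro powr_mono2) auto
        have TV: "T * \<epsilon>\<^sup>2 * Y \<le> T * V - a"
          using far mult_left_mono[OF MV, of T] T by linarith
        have "T\<^sup>2 * \<epsilon>\<^sup>2 * Y = (T * \<epsilon>\<^sup>2 * Y) * T" by (simp add: power2_eq_square)
        also have "\<dots> \<le> (T * V - a) * T" using TV T by (intro mult_right_mono) auto
        also have "\<dots> \<le> (T * V - a) * ((T * V + a) / V)"
          using TV T V a Y by (intro mult_left_mono) (auto simp: field_simps intro: order_trans[rotated])
        finally have "T\<^sup>2 * \<epsilon>\<^sup>2 * Y / (2 * q * c) \<le> ((T * V - a) * ((T * V + a) / V)) / (2 * q * u x)"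
          using q u(2)[OF x] uc[OF x] T Y c TV V a \<epsilon> Tu[OF x, folded V_def]
          by (intro frac_le mult_left_mono mult_nonneg_nonneg divide_nonneg_nonneg) auto
        also have "\<dots> = lich q T A (u x)"
          using u(2)[OF x] V q by (simp add: lich_factored a(2) flip: V_def) (simp add: field_simps power2_eq_square)
        finally show ?thesis by (simp add: B_def)
      qed
      have B1: "u1 x \<le> B * (x - L)" if x: "x \<in> {0..L}" for x
      proof -
        have "u1 x - B * (x - L) \<le> u1 L - B * (L - L)"
        proof (rule DERIV_within_nonneg_mono[where f = "\<lambda>x. u1 x - B * (x - L)"])
          fix y assume y: "y \<in> {0..L}"
          show "((\<lambda>x. u1 x - B * (x - L)) has_real_derivative lich q T A (u y) - B) (at y within {0..L})"
            by (auto intro!: derivative_eq_intros U y)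
          show "0 \<le> lich q T A (u y) - B" using B[OF y] by simp
        qed (use x in auto)
        then show ?thesis using U(2) by simp
      qed
      have "u L - B * (L - L)\<^sup>2 / 2 \<le> u 0 - B * (0 - L)\<^sup>2 / 2"
      proof (rule DERIV_within_nonpos_antimono[where f = "\<lambda>x. u x - B * (x - L)\<^sup>2 / 2"])
        fix y assume y: "y \<in> {0..L}"
        show "((\<lambda>x. u x - B * (x - L)\<^sup>2 / 2) has_real_derivative u1 y - B * (y - L)) (at y within {0..L})"
          by (auto intro!: derivative_eq_intros U y)
        show "u1 y - B * (y - L) \<le> 0" using B1[OF y] by simp
      qed (use L in auto)
      then have "B * L\<^sup>2 / 2 < c" using U(1) uL by simp
      moreover have "Y = c powr (q - 2) * c\<^sup>2"
        using c by (simp add: Y_def powr_diff powr_numeral)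
      then have "B = T\<^sup>2 * \<epsilon>\<^sup>2 * c powr (q - 2) * c / (2 * q)"
        using c q by (simp add: B_def power2_eq_square)
      ultimately have "(L\<^sup>2 * T\<^sup>2 * \<epsilon>\<^sup>2 * c powr (q - 2)) * c < 4 * q * c"
        using q by (simp add: field_simps)
      then show False using large c by simp
    qed
    have "(T * M - a)\<^sup>2 / M \<le> T * (T * \<epsilon>\<^sup>2 * Y)"
    proof -
      have "(T * M - a)\<^sup>2 / M = ((T * M - a) / M) * (T * M - a)" by (simp add: power2_eq_square)
      also have "\<dots> \<le> T * (T * \<epsilon>\<^sup>2 * Y)"
        using TM close T M a Y by (intro mult_mono) (auto simp: field_simps)
      finally show ?thesis .
    qed
    then have "Y * ((T * M - a)\<^sup>2 / M) \<le> (T * \<epsilon> * Y)\<^sup>2"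
      using mult_left_mono[of "(T * M - a)\<^sup>2 / M" "T * (T * \<epsilon>\<^sup>2 * Y)" Y] Y
      by (simp add: power2_eq_square mult_ac)
    then have S2: "(T * Y - a)\<^sup>2 - (T * \<epsilon> * Y)\<^sup>2 \<le> (q * c powr (q / 2) * u1 0)\<^sup>2"
      using energy by linarith
    have S0: "q * c powr (q / 2) * u1 0 \<le> 0"
      using u1[of 0] L q by (simp add: mult_nonneg_nonpos)
    \<comment> \<open>For nonnegative \<open>X\<close> and \<open>W\<close> one has
      \<open>X\<^sup>2 \<le> (X + W)\<^sup>2 - W\<^sup>2\<close>; here
      \<open>W = T * \<epsilon> * Y\<close> and \<open>X + W = T * Y - a\<close>.\<close>
    have "q * c powr (q / 2) * u1 0 \<le> - ((T * Y - a) - T * \<epsilon> * Y)"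
    proof (rule ccontr)
      assume "\<not> ?thesis"
      then have lt: "- (q * c powr (q / 2) * u1 0) < (T * Y - a) - T * \<epsilon> * Y" by simp
      have W: "0 \<le> T * \<epsilon> * Y" using T \<epsilon> Y by simp
      have "(q * c powr (q / 2) * u1 0)\<^sup>2 < ((T * Y - a) - T * \<epsilon> * Y)\<^sup>2"
        using power_strict_mono[OF lt, of 2] S0 by simp
      also have "\<dots> = (T * Y - a)\<^sup>2 - (T * \<epsilon> * Y)\<^sup>2 - 2 * ((T * \<epsilon> * Y) * ((T * Y - a) - T * \<epsilon> * Y))"
        by (simp add: power2_eq_square algebra_simps)
      also have "\<dots> \<le> (T * Y - a)\<^sup>2 - (T * \<epsilon> * Y)\<^sup>2"
        using mult_nonneg_nonneg[OF W, of "T * Y - a - T * \<epsilon> * Y"] lt S0 by linarith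
      finally show False using S2 by linarith
    qed
    then show ?thesis by (simp add: Y_def a_def)
  qed
qed

section \<open>Gluing two half circles\<close>

text \<open>The filter at \<open>x\<close> within a union is the supremum of the two filters. If
  \<open>x\<close> lies outside one of the closed intervals, the filter within that interval is
  trivial.\<close>

lemma DERIV_Icc_join:
  fixes f :: "real \<Rightarrow> real"
  assumes "\<And>x. x \<in> {a..m} \<Longrightarrow> (f has_real_derivative f' x) (at x within {a..m})"
    and "\<And>x. x \<in> {m..b} \<Longrightarrow> (f has_real_derivative f' x) (at x within {m..b})"
    and "a \<le> m" "m \<le> b" and x: "x \<in> {a..b}"
  shows "(f has_real_derivative f' x) (at x within {a..b})"
proof -
  have triv: "(f has_real_derivative f' x) (at x within {s..t})" if "x \<notin> {s..t}" for s t
  proof -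
    have "\<not> x islimpt {s..t}"
      using that closed_atLeastAtMost[of s t] unfolding closed_limpt by blast
    then have "at x within {s..t} = bot" by (simp add: trivial_limit_within)
    then show ?thesis unfolding has_field_derivative_iff by simp
  qed
  have "(f has_real_derivative f' x) (at x within {a..m})"
    by (cases "x \<in> {a..m}") (fact assms(1), fact triv)
  moreover have "(f has_real_derivative f' x) (at x within {m..b})"
    by (cases "x \<in> {m..b}") (fact assms(2), fact triv)
  ultimately have "(f has_real_derivative f' x) (at x within {a..m} \<union> {m..b})"
    unfolding has_field_derivative_iff unfolding at_within_union by (rule filterlim_sup)
  then show ?thesis using ivl_disj_un_two_touch(4)[OF assms(3,4)] by simp
qed

text \<open>Even reflection about \<open>L\<close>; the Neumann condition makes the oddly reflected
  slope continuous there. The slopes at the two ends are opposite, so matching two such arcs at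
  \<open>0\<close> also matches them at the other end.\<close>

lemma mixed_bvp_reflect:
  fixes u u1 f :: "real \<Rightarrow> real"
  assumes "0 < L" "mixed_bvp L f c u u1" "\<And>x. x \<in> {0..L} \<Longrightarrow> 0 < u x"
  obtains a a1 where "a 0 = c" "a (2 * L) = c" "a1 0 = u1 0" "a1 (2 * L) = - u1 0"
    "\<And>x. x \<in> {0..2 * L} \<Longrightarrow> 0 < a x"
    "\<And>x. x \<in> {0..2 * L} \<Longrightarrow> (a has_real_derivative a1 x) (at x within {0..2 * L})"
    "\<And>x. x \<in> {0..2 * L} \<Longrightarrow> (a1 has_real_derivative f (a x)) (at x within {0..2 * L})"
proof
  have U: "u 0 = c" "u1 L = 0"
    and Du: "\<And>x. x \<in> {0..L} \<Longrightarrow> (u has_real_derivative u1 x) (at x within {0..L})"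
    and Du1: "\<And>x. x \<in> {0..L} \<Longrightarrow> (u1 has_real_derivative f (u x)) (at x within {0..L})"
    using assms(2) by (auto simp: mixed_bvp_def)
  let ?a = "\<lambda>x. if x \<le> L then u x else u (2 * L - x)"
  let ?a1 = "\<lambda>x. if x \<le> L then u1 x else - u1 (2 * L - x)"
  have refl: "((\<lambda>x. h (2 * L - x)) has_real_derivative - h' (2 * L - x)) (at x within {L..2 * L})"
    if h: "\<And>x. x \<in> {0..L} \<Longrightarrow> (h has_real_derivative h' x) (at x within {0..L})" and x: "x \<in> {L..2 * L}"
    for h h' :: "real \<Rightarrow> real" and x
  proof -
    have "((\<lambda>x. 2 * L - x) has_real_derivative -1) (at x within {L..2 * L})"
      by (auto intro!: derivative_eq_intros)
    moreover have "(\<lambda>x. 2 * L - x) ` {L..2 * L} \<subseteq> {0..L}" by auto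
    ultimately have "(h \<circ> (\<lambda>x. 2 * L - x) has_real_derivative h' (2 * L - x) * (-1)) (at x within {L..2 * L})"
      using x by (intro DERIV_image_chain has_field_derivative_subset[OF h]) auto
    then show ?thesis by (simp add: o_def)
  qed
  have 1: "(?a has_real_derivative ?a1 x) (at x within {0..L})" if "x \<in> {0..L}" for x
    by (rule has_field_derivative_transform_within[where d = 1, OF Du[OF that, THEN DERIV_cong]]) (use that in auto)
  have 2: "(?a has_real_derivative ?a1 x) (at x within {L..2*L})" if "x \<in> {L..2*L}" for x
    by (rule has_field_derivative_transform_within[where d = 1, OF refl[of u, OF Du that, THEN DERIV_cong]])
      (use that U in auto)
  have 3: "(?a1 has_real_derivative f (?a x)) (at x within {0..L})" if "x \<in> {0..L}" for x
    by (rule has_field_derivative_transform_within[where d = 1, OF Du1[OF that, THEN DERIV_cong]]) (use that in auto)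
  have 4: "(?a1 has_real_derivative f (?a x)) (at x within {L..2*L})" if "x \<in> {L..2*L}" for x
    by (rule has_field_derivative_transform_within[where d = 1, OF DERIV_minus[OF refl[of u1, OF Du1 that], THEN DERIV_cong]])
      (use that U in auto)
  show "(?a has_real_derivative ?a1 x) (at x within {0..2*L})" if "x \<in> {0..2*L}" for x
    by (rule DERIV_Icc_join[OF 1 2]) (use that assms(1) in auto)
  show "(?a1 has_real_derivative f (?a x)) (at x within {0..2*L})" if "x \<in> {0..2*L}" for x
    by (rule DERIV_Icc_join[OF 3 4]) (use that assms(1) in auto)
  show "?a 0 = c" "?a1 0 = u1 0" using U assms(1) by auto
  show "?a (2 * L) = c" "?a1 (2 * L) = - u1 0" using U assms(1) by auto
  show "0 < ?a x" if "x \<in> {0..2*L}" for x using assms(3)[of x] assms(3)[of "2 * L - x"] that by auto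
qed

text \<open>\<open>arccos (cos x)\<close> is the distance of \<open>x\<close> to \<open>2 \<pi> \<int>\<close>; so \<open>glue a b\<close> is the \<open>2 \<pi>\<close>-periodic function
  that equals \<open>a x\<close> on \<open>[0, \<pi>]\<close> and \<open>b (- x)\<close> on \<open>(-\<pi>, 0)\<close>.\<close>

definition glue :: "(real \<Rightarrow> real) \<Rightarrow> (real \<Rightarrow> real) \<Rightarrow> real \<Rightarrow> real" where
  "glue a b x = (if 0 \<le> sin x then a (arccos (cos x)) else b (arccos (cos x)))"

lemma arccos_cos_mem: "arccos (cos x) \<in> {0..pi}"
  by (simp add: arccos_lbound arccos_ubound)

lemma periodic_glue: "periodic_S1 (glue a b)"
  by (simp add: periodic_S1_def glue_def)

lemma continuous_on_arccos_cos:
  assumes "continuous_on {0..pi} a"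
  shows "continuous_on UNIV (\<lambda>x. a (arccos (cos x)))"
  by (rule continuous_on_compose2[OF assms]) (auto intro!: continuous_intros arccos_lbound arccos_ubound)

lemma continuous_on_glue:
  assumes "continuous_on {0..pi} a" "continuous_on {0..pi} b" "a 0 = b 0" "a pi = b pi"
  shows "continuous_on UNIV (glue a b)"
proof -
  have "continuous_on ({x. 0 \<le> sin x} \<union> {x. sin x \<le> 0}) (glue a b)"
    unfolding glue_def
  proof (rule continuous_on_cases)
    show "\<forall>x. x \<in> {x. 0 \<le> sin x} \<and> \<not> 0 \<le> sin x \<or> x \<in> {x. sin x \<le> 0} \<and> 0 \<le> sin x \<longrightarrow>
        a (arccos (cos x)) = b (arccos (cos x))"
    proof (intro allI impI)
      fix x :: real
      assume "x \<in> {x. 0 \<le> sin x} \<and> \<not> 0 \<le> sin x \<or> x \<in> {x. sin x \<le> 0} \<and> 0 \<le> sin x"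
      then have "sin x = 0" by auto
      then have "cos x = 1 \<or> cos x = - 1" using sin_zero_abs_cos_one[of x] by (auto simp: abs_if split: if_splits)
      then show "a (arccos (cos x)) = b (arccos (cos x))" using assms(3,4) by auto
    qed
  qed (auto intro!: closed_Collect_le continuous_intros continuous_on_subset[OF continuous_on_arccos_cos] assms)
  moreover have "{x::real. 0 \<le> sin x} \<union> {x. sin x \<le> 0} = UNIV" by auto
  ultimately show ?thesis by simp
qed

lemma cos_strict_bounds:
  fixes x :: real
  assumes "sin x \<noteq> 0"
  shows "- 1 < cos x" "cos x < 1"
proof -
  have "0 < (sin x)\<^sup>2" using assms by simp
  then have "(cos x)\<^sup>2 < 1" using sin_cos_squared_add[of x] by linarith
  then have "\<bar>cos x\<bar> < 1" by (simp add: abs_square_less_1)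
  then show "- 1 < cos x" "cos x < 1" by linarith+
qed

lemma DERIV_arccos_cos:
  fixes x :: real
  assumes "sin x \<noteq> 0"
  shows "((\<lambda>x. arccos (cos x)) has_real_derivative sgn (sin x)) (at x)"
proof -
  have c: "- 1 < cos x" "cos x < 1" using cos_strict_bounds[OF assms] by auto
  have "((\<lambda>x. arccos (cos x)) has_real_derivative inverse (- sqrt (1 - (cos x)\<^sup>2)) * (- sin x)) (at x)"
    by (rule DERIV_chain2[OF DERIV_arccos[OF c] DERIV_cos])
  moreover have "sqrt (1 - (cos x)\<^sup>2) = \<bar>sin x\<bar>"
    by (subst sin_squared_eq[symmetric]) simp
  ultimately show ?thesis using assms
    by (cases "0 < sin x") auto
qed

lemma arccos_cos_interior:
  assumes "sin x \<noteq> 0"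
  shows "0 < arccos (cos x)" "arccos (cos x) < pi"
proof -
  note c = cos_strict_bounds[OF assms]
  show "0 < arccos (cos x)" "arccos (cos x) < pi"
    using arccos_lt_bounded[of "cos x"] c by auto
qed

text \<open>The sign of \<open>b'\<close> changes because \<open>arccos (cos x)\<close> has slope
  \<open>-1\<close> where \<open>sin x < 0\<close>.\<close>

lemma DERIV_glue:
  assumes a: "\<And>r. r \<in> {0..pi} \<Longrightarrow> (a has_real_derivative a' r) (at r within {0..pi})"
    and b: "\<And>r. r \<in> {0..pi} \<Longrightarrow> (b has_real_derivative b' r) (at r within {0..pi})"
    and x: "sin x \<noteq> 0"
  shows "(glue a b has_real_derivative glue a' (\<lambda>r. - b' r) x) (at x)"
proof -
  note I = arccos_cos_interior[OF x]
  have chain: "((\<lambda>x. h (arccos (cos x))) has_real_derivative h' (arccos (cos x)) * sgn (sin x)) (at x)"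
    if "\<And>r. r \<in> {0..pi} \<Longrightarrow> (h has_real_derivative h' r) (at r within {0..pi})" for h h'
    by (rule DERIV_chain2[OF _ DERIV_arccos_cos[OF x]])
      (use that[of "arccos (cos x)"] I at_within_Icc_at[OF I] in auto)
  show ?thesis
  proof (cases "0 < sin x")
    case True
    have "open {x::real. 0 < sin x}" by (intro open_Collect_less continuous_intros)
    from has_field_derivative_transform_within_open[OF chain[of a a', OF a] this, of "glue a b"]
    show ?thesis using True by (simp add: glue_def)
  next
    case False
    then have neg: "sin x < 0" using x by simp
    have "open {x::real. sin x < 0}" by (intro open_Collect_less continuous_intros)
    from has_field_derivative_transform_within_open[OF chain[of b b', OF b] this, of "glue a b"]
    show ?thesis using neg by (simp add: glue_def)
  qed
qed

lemma finite_sin_zeros: "finite {x \<in> {a..b}. sin x = (0::real)}"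
proof (rule finite_subset)
  show "{x \<in> {a..b}. sin x = 0} \<subseteq> (\<lambda>i. of_int i * pi) ` {\<lfloor>a / pi\<rfloor>..\<lceil>b / pi\<rceil>}"
  proof
    fix x assume "x \<in> {x \<in> {a..b}. sin x = 0}"
    then obtain i :: int where i: "x = of_int i * pi" "a \<le> x" "x \<le> b"
      by (auto simp: sin_zero_iff_int2)
    then have "a / pi \<le> i" "i \<le> b / pi" by (simp_all add: field_simps)
    then have "i \<in> {\<lfloor>a / pi\<rfloor>..\<lceil>b / pi\<rceil>}"
      using floor_mono[of "a / pi" "of_int i"] ceiling_mono[of "of_int i" "b / pi"] by simp
    then show "x \<in> (\<lambda>i. of_int i * pi) ` {\<lfloor>a / pi\<rfloor>..\<lceil>b / pi\<rceil>}" using i(1) by blast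
  qed
qed simp

lemma set_integrable_bounded_Icc:
  fixes g :: "real \<Rightarrow> real"
  assumes "g \<in> borel_measurable borel" "\<And>x. x \<in> {a..b} \<Longrightarrow> \<bar>g x\<bar> \<le> B"
  shows "set_integrable lborel {a..b} g"
  unfolding set_integrable_def
proof (rule integrableI_bounded_set_indicator[where B = B])
  show "g \<in> borel_measurable lborel" using assms(1) by simp
qed (use assms(2) in \<open>auto simp: emeasure_lborel_Icc_eq\<close>)

text \<open>The glued function is continuous and differentiable off the zeros of \<open>sin\<close>,
  which are finite in number on each bounded interval, so the fundamental theorem of calculus holds.
  The derivative is bounded, hence square integrable on the circle.\<close>

lemma W1p_glue:
  assumes a: "\<And>r. r \<in> {0..pi} \<Longrightarrow> (a has_real_derivative a' r) (at r within {0..pi})"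
    and b: "\<And>r. r \<in> {0..pi} \<Longrightarrow> (b has_real_derivative b' r) (at r within {0..pi})"
    and ca: "continuous_on {0..pi} a'" and cb: "continuous_on {0..pi} b'"
    and eq: "a 0 = b 0" "a pi = b pi"
  shows "W1p 2 (glue a b) (glue a' (\<lambda>r. - b' r))"
proof -
  let ?F = "glue a b" and ?g = "glue a' (\<lambda>r. - b' r)"
  have cF: "continuous_on UNIV ?F"
    by (rule continuous_on_glue[OF DERIV_continuous_on[OF a] DERIV_continuous_on[OF b] eq])
  have [measurable]: "(\<lambda>x. a' (arccos (cos x))) \<in> borel_measurable borel"
    "(\<lambda>x. b' (arccos (cos x))) \<in> borel_measurable borel"
    by (intro borel_measurable_continuous_onI continuous_on_arccos_cos ca cb)+
  have meas: "?g \<in> borel_measurable borel"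
    unfolding glue_def by measurable
  have "bounded (a' ` {0..pi} \<union> b' ` {0..pi})"
    unfolding bounded_Un
    by (intro conjI compact_imp_bounded compact_continuous_image ca cb compact_Icc)
  then obtain B where B: "\<And>y. y \<in> a' ` {0..pi} \<union> b' ` {0..pi} \<Longrightarrow> \<bar>y\<bar> \<le> B"
    unfolding bounded_iff real_norm_def by blast
  have bd: "\<bar>?g x\<bar> \<le> B" for x
    using B[of "a' (arccos (cos x))"] B[of "b' (arccos (cos x))"] arccos_cos_mem[of x]
    unfolding glue_def by auto
  have int: "set_integrable lborel {s..t} ?g" for s t
    by (rule set_integrable_bounded_Icc[OF meas]) (rule bd)
  have ftc: "(LBINT s=ereal s..ereal t. ?g s) = ?F t - ?F s" if "s \<le> t" for s t
  proof -
    have "(?g has_integral ?F t - ?F s) {s..t}"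
    proof (rule fundamental_theorem_of_calculus_interior_strong[OF finite_sin_zeros[of s t] that])
      fix x assume "x \<in> {s<..<t} - {x \<in> {s..t}. sin x = 0}"
      then show "(?F has_vector_derivative ?g x) (at x)"
        unfolding has_real_derivative_iff_has_vector_derivative[symmetric]
        by (intro DERIV_glue a b) auto
    qed (rule continuous_on_subset[OF cF], simp)
    then show ?thesis
      by (simp add: interval_integral_eq_integral[OF that int] integral_unique)
  qed
  have rep: "?F x = ?F 0 + (LBINT s=0..x. ?g s)" for x
  proof (cases "0 \<le> x")
    case True
    then show ?thesis using ftc[of 0 x] by (simp add: zero_ereal_def)
  next
    case False
    then show ?thesis using ftc[of x 0] interval_integral_endpoints_reverse[of 0 "ereal x" ?g]
      by (simp add: zero_ereal_def)
  qed
  have sq: "set_integrable lborel {-pi..pi} (\<lambda>x. \<bar>?g x\<bar> powr 2)"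
  proof (rule set_integrable_bounded_Icc[where B = "B powr 2"])
    show "(\<lambda>x. \<bar>?g x\<bar> powr 2) \<in> borel_measurable borel" using meas by measurable
    show "\<bar>\<bar>?g x\<bar> powr 2\<bar> \<le> B powr 2" for x
      using powr_mono2[of 2 "\<bar>?g x\<bar>" B] bd[of x] by simp
  qed
  have "?g \<in> borel_measurable lborel" using meas by simp
  then show ?thesis
    unfolding W1p_def by (intro conjI allI periodic_glue sq rep)
qed

section \<open>Matching the slopes\<close>

text \<open>Intermediate value theorem for the sum of the two initial slopes: it is nonnegative at
  \<open>c0\<close>, below both equilibria, and nonpositive at \<open>c1\<close> by adding the two
  upper slope bounds and using \<open>bal\<close>.\<close>

lemma matching_value:
  fixes A B :: "real \<Rightarrow> real"
  assumes L: "0 < L" and q: "2 < q" and T: "0 < T" "0 < T'"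
    and nn: "\<And>c. 0 \<le> A c" "\<And>c. 0 \<le> B c"
    and cont: "continuous_on {0<..} A" "continuous_on {0<..} B"
    and c0: "0 < c0" "(T * c0 powr q)\<^sup>2 \<le> A c0" "(T' * c0 powr q)\<^sup>2 \<le> B c0"
    and c1: "c0 \<le> c1" "4 * q \<le> L\<^sup>2 * T\<^sup>2 * \<epsilon>\<^sup>2 * c1 powr (q - 2)"
      "4 * q \<le> L\<^sup>2 * T'\<^sup>2 * \<epsilon>\<^sup>2 * c1 powr (q - 2)"
    and \<epsilon>: "0 < \<epsilon>" and bal: "sqrt (A c1) + sqrt (B c1) \<le> (T + T') * (1 - \<epsilon>) * c1 powr q"
  obtains c u u1 v v1 where "0 < c"
    "mixed_bvp L (lich q T (A c)) c u u1" "\<And>x. x \<in> {0..L} \<Longrightarrow> 0 < u x"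
    "mixed_bvp L (lich q T' (B c)) c v v1" "\<And>x. x \<in> {0..L} \<Longrightarrow> 0 < v x"
    "u1 0 + v1 0 = 0"
proof -
  \<comment> \<open>Solutions can now be chosen for every real \<open>c\<close>, with positive
    boundary value; on \<open>{c0..c1}\<close> nothing changes.\<close>
  define m where "m c = max c0 c" for c
  have m: "0 < m c" for c using c0 by (simp add: m_def)
  have m_id: "m c = c" if "c0 \<le> c" for c using that by (simp add: m_def)
  have "\<forall>c. \<exists>u u1. mixed_bvp L (lich q T (A (m c))) (m c) u u1 \<and> (\<forall>x\<in>{0..L}. 0 < u x)"
    using lich_bvp_exists[OF L m q T(1) nn(1)] by blast
  then obtain u u1 where u: "\<And>c. mixed_bvp L (lich q T (A (m c))) (m c) (u c) (u1 c)"
      "\<And>c x. x \<in> {0..L} \<Longrightarrow> 0 < u c x"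
    by metis
  have "\<forall>c. \<exists>u u1. mixed_bvp L (lich q T' (B (m c))) (m c) u u1 \<and> (\<forall>x\<in>{0..L}. 0 < u x)"
    using lich_bvp_exists[OF L m q T(2) nn(2)] by blast
  then obtain v v1 where v: "\<And>c. mixed_bvp L (lich q T' (B (m c))) (m c) (v c) (v1 c)"
      "\<And>c x. x \<in> {0..L} \<Longrightarrow> 0 < v c x"
    by metis
  have tm: "(m \<longlongrightarrow> m c) (at c)" for c
    unfolding m_def by (intro tendsto_intros)
  have tA: "((\<lambda>c. G (m c)) \<longlongrightarrow> G (m c)) (at c)" if "continuous_on {0<..} G" for G :: "real \<Rightarrow> real" and c
    using that m by (intro isCont_tendsto_compose[OF _ tm]) (auto simp: continuous_on_eq_continuous_at)
  have q1: "0 < q" "1 \<le> q" using q by auto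
  have "((\<lambda>c. u1 c 0) \<longlongrightarrow> u1 c 0) (at c)" "((\<lambda>c. v1 c 0) \<longlongrightarrow> v1 c 0) (at c)" for c
    by (rule tendsto_initial_slope[OF L u u mono_on_lich continuous_on_lich tm uniform_limit_lich]
        tendsto_initial_slope[OF L v v mono_on_lich continuous_on_lich tm uniform_limit_lich];
        use q1 nn tA cont in auto)+
  then have cont': "continuous_on {c0..c1} (\<lambda>c. u1 c 0 + v1 c 0)"
    by (auto intro!: continuous_at_imp_continuous_on continuous_add simp: isCont_def)
  have lo: "0 \<le> u1 c0 0 + v1 c0 0"
    using lich_below_equilibrium[OF L c0(1) q T(1) nn(1), of c0 "u c0" "u1 c0"]
      lich_below_equilibrium[OF L c0(1) q T(2) nn(2), of c0 "v c0" "v1 c0"] u[where c=c0] v[where c=c0] c0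
    by (simp add: m_id)
  have c1': "0 < c1" using c0 c1 by simp
  have hi: "u1 c1 0 + v1 c1 0 \<le> 0"
  proof -
    have "q * c1 powr (q / 2) * u1 c1 0 \<le> sqrt (A c1) - T * c1 powr q + T * \<epsilon> * c1 powr q"
      using lich_slope_upper[OF L c1' q T(1) nn(1) _ _ \<epsilon> c1(2), of c1 "u c1" "u1 c1"] u[where c=c1] c1
      by (simp add: m_id)
    moreover have "q * c1 powr (q / 2) * v1 c1 0 \<le> sqrt (B c1) - T' * c1 powr q + T' * \<epsilon> * c1 powr q"
      using lich_slope_upper[OF L c1' q T(2) nn(2) _ _ \<epsilon> c1(3), of c1 "v c1" "v1 c1"] v[where c=c1] c1
      by (simp add: m_id)
    ultimately have "(q * c1 powr (q / 2)) * (u1 c1 0 + v1 c1 0) \<le> 0"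
      using bal by (simp add: algebra_simps)
    then show ?thesis using q c1' by (simp add: mult_le_0_iff)
  qed
  obtain c where "c0 \<le> c" "c \<le> c1" "u1 c 0 + v1 c 0 = 0"
    using IVT2'[OF hi lo c1(1) cont'] by blast
  then show ?thesis
    using that[of c "u c" "u1 c" "v c" "v1 c"] u[where c=c] v[where c=c] c0 by (simp add: m_id)
qed

lemma sqrt_sum_le: "0 \<le> a \<Longrightarrow> sqrt (a + z\<^sup>2) \<le> sqrt a + \<bar>z\<bar>"
  using sqrt_add_le_add_sqrt[of a "z\<^sup>2"] by simp

lemma matched_profiles:
  fixes q t \<alpha> \<mu> g :: real
  assumes L: "0 < L" and q: "2 < q" and t: "1 < \<bar>t\<bar>" and \<alpha>: "0 \<le> \<alpha>" "\<alpha> \<noteq> 0 \<or> \<mu> \<noteq> 0"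
    and g: "\<bar>g\<bar> \<le> 1"
  obtains c u u1 v v1 where "0 < c"
    "mixed_bvp L (lich q \<bar>t + 1\<bar> (\<alpha> + (\<mu> + c powr q * (g + 1))\<^sup>2)) c u u1" "\<And>x. x \<in> {0..L} \<Longrightarrow> 0 < u x"
    "mixed_bvp L (lich q \<bar>t - 1\<bar> (\<alpha> + (\<mu> + c powr q * (g - 1))\<^sup>2)) c v v1" "\<And>x. x \<in> {0..L} \<Longrightarrow> 0 < v x"
    "u1 0 + v1 0 = 0"
proof -
  define A where "A s c = \<alpha> + (\<mu> + c powr q * (g + s))\<^sup>2" for s c :: real
  have T: "0 < \<bar>t + 1\<bar>" "0 < \<bar>t - 1\<bar>" and sumT: "\<bar>t + 1\<bar> + \<bar>t - 1\<bar> = 2 * \<bar>t\<bar>" using t by auto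
  have nn: "0 \<le> A s c" for s c using \<alpha> by (simp add: A_def)
  have cont: "continuous_on {0<..} (A s)" for s
    unfolding A_def by (auto intro!: continuous_intros)
  have "0 < \<alpha> + \<mu>\<^sup>2" using \<alpha> by (auto intro: add_pos_nonneg add_nonneg_pos)
  \<comment> \<open>With \<open>y\<close> standing for \<open>c powr q\<close>, the right side tends
    to \<open>\<alpha> + \<mu>\<^sup>2 > 0\<close> and the left to \<open>0\<close>.\<close>
  have "\<forall>\<^sub>F y in at_right 0. (T * y)\<^sup>2 < \<alpha> + (\<mu> + y * (g + s))\<^sup>2" for s T
  proof -
    have lim: "((\<lambda>y. \<alpha> + (\<mu> + y * (g + s))\<^sup>2 - (T * y)\<^sup>2) \<longlongrightarrow> \<alpha> + (\<mu> + 0 * (g + s))\<^sup>2 - (T * 0)\<^sup>2) (at_right 0)"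
      by (intro tendsto_intros)
    show ?thesis
      using order_tendstoD(1)[OF lim, of 0] \<open>0 < \<alpha> + \<mu>\<^sup>2\<close> by simp
  qed
  from this[of "\<bar>t + 1\<bar>" 1] this[of "\<bar>t - 1\<bar>" "- 1"] eventually_at_right_less[of "0::real"]
  have "\<forall>\<^sub>F y in at_right 0. (\<bar>t + 1\<bar> * y)\<^sup>2 < \<alpha> + (\<mu> + y * (g + 1))\<^sup>2 \<and>
      (\<bar>t - 1\<bar> * y)\<^sup>2 < \<alpha> + (\<mu> + y * (g - 1))\<^sup>2 \<and> 0 < y"
    by eventually_elim simp
  then obtain y where y: "(\<bar>t + 1\<bar> * y)\<^sup>2 < \<alpha> + (\<mu> + y * (g + 1))\<^sup>2"
      "(\<bar>t - 1\<bar> * y)\<^sup>2 < \<alpha> + (\<mu> + y * (g - 1))\<^sup>2" "0 < y"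
    using eventually_happens'[OF trivial_limit_at_right_real] by blast
  define c0 where "c0 = y powr (1 / q)"
  have c0: "0 < c0" "c0 powr q = y" using y q by (auto simp: c0_def powr_powr)
  \<comment> \<open>This makes the coefficient in the balance condition
    \<open>\<bar>t\<bar> + 1\<close>, halfway between \<open>2\<close> and
    \<open>2 * \<bar>t\<bar>\<close>; the surplus over \<open>2\<close> absorbs the constant
    \<open>2 * S\<close> for large \<open>c\<close>.\<close>
  define \<epsilon> where "\<epsilon> = (\<bar>t\<bar> - 1) / (2 * \<bar>t\<bar>)"
  have \<epsilon>: "0 < \<epsilon>" using t by (simp add: \<epsilon>_def)
  have \<epsilon>': "(\<bar>t + 1\<bar> + \<bar>t - 1\<bar>) * (1 - \<epsilon>) = \<bar>t\<bar> + 1"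
    unfolding sumT \<epsilon>_def using t by (simp add: field_simps)
  have big: "\<exists>z. \<forall>x\<ge>z. K \<le> x powr s" if "0 < s" for K s :: real
  proof (intro exI allI impI)
    fix x assume x: "max 1 K powr (1 / s) \<le> x"
    have "max 1 K = (max 1 K powr (1 / s)) powr s" using that by (simp add: powr_powr)
    also have "\<dots> \<le> x powr s" using x that by (intro powr_mono2) auto
    finally show "K \<le> x powr s" by simp
  qed
  define S where "S = sqrt \<alpha> + \<bar>\<mu>\<bar>"
  have qq: "0 < q - 2" "0 < q" using q by auto
  obtain z1 where z1: "\<And>x. z1 \<le> x \<Longrightarrow> 4 * q / (L\<^sup>2 * \<bar>t + 1\<bar>\<^sup>2 * \<epsilon>\<^sup>2) \<le> x powr (q - 2)"
    using big[OF qq(1)] by blast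
  obtain z2 where z2: "\<And>x. z2 \<le> x \<Longrightarrow> 4 * q / (L\<^sup>2 * \<bar>t - 1\<bar>\<^sup>2 * \<epsilon>\<^sup>2) \<le> x powr (q - 2)"
    using big[OF qq(1)] by blast
  obtain z3 where z3: "\<And>x. z3 \<le> x \<Longrightarrow> 2 * S / (\<bar>t\<bar> - 1) \<le> x powr q"
    using big[OF qq(2)] by blast
  define c1 where "c1 = max c0 (max z1 (max z2 z3))"
  have c1: "c0 \<le> c1" "z1 \<le> c1" "z2 \<le> c1" "z3 \<le> c1" by (auto simp: c1_def)
  have l1: "4 * q \<le> L\<^sup>2 * \<bar>t + 1\<bar>\<^sup>2 * \<epsilon>\<^sup>2 * c1 powr (q - 2)"
    using z1[OF c1(2)] L T \<epsilon> by (simp add: pos_divide_le_eq mult.commute)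
  have l2: "4 * q \<le> L\<^sup>2 * \<bar>t - 1\<bar>\<^sup>2 * \<epsilon>\<^sup>2 * c1 powr (q - 2)"
    using z2[OF c1(3)] L T \<epsilon> by (simp add: pos_divide_le_eq mult.commute)
  have l3: "sqrt (A 1 c1) + sqrt (A (- 1) c1) \<le> (\<bar>t + 1\<bar> + \<bar>t - 1\<bar>) * (1 - \<epsilon>) * c1 powr q"
  proof -
    define Y where "Y = c1 powr q"
    have Y: "0 \<le> Y" by (simp add: Y_def)
    have "sqrt (A s c1) \<le> S + Y * \<bar>g + s\<bar>" for s
    proof -
      have "sqrt (A s c1) \<le> sqrt \<alpha> + \<bar>\<mu> + Y * (g + s)\<bar>"
        unfolding A_def Y_def by (rule sqrt_sum_le[OF \<alpha>(1)])
      also have "\<dots> \<le> sqrt \<alpha> + (\<bar>\<mu>\<bar> + Y * \<bar>g + s\<bar>)"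
        using abs_triangle_ineq[of \<mu> "Y * (g + s)"] Y by (simp add: abs_mult)
      finally show ?thesis by (simp add: S_def)
    qed
    from this[of 1] this[of "- 1"]
    have "sqrt (A 1 c1) + sqrt (A (- 1) c1) \<le> 2 * S + Y * (\<bar>g + 1\<bar> + \<bar>g - 1\<bar>)"
      by (simp add: algebra_simps)
    also have "\<bar>g + 1\<bar> + \<bar>g - 1\<bar> = 2" using g by linarith
    also have "2 * S + Y * 2 \<le> (\<bar>t\<bar> - 1) * Y + Y * 2"
      using z3[OF c1(4)] t by (simp add: pos_divide_le_eq mult.commute Y_def)
    also have "\<dots> = (\<bar>t\<bar> + 1) * Y" by (simp add: algebra_simps)
    finally show ?thesis unfolding \<epsilon>' Y_def .
  qed
  show ?thesis
    by (rule matching_value[OF L q T nn nn cont cont c0(1) _ _ c1(1) l1 l2 \<epsilon> l3])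
      (use y that in \<open>auto simp: A_def c0(2)\<close>)
qed

section \<open>Solutions of the coupled system\<close>

lemma smooth_S1_continuous:
  assumes "smooth_S1 f"
  shows "continuous_on UNIV f" "continuous_on UNIV (deriv f)"
    "\<And>x. (f has_real_derivative deriv f x) (at x)"
proof -
  have d: "((deriv ^^ k) f) differentiable (at x)" for k x
    using assms by (simp add: smooth_S1_def)
  show "continuous_on UNIV f" "continuous_on UNIV (deriv f)"
    using d[of 0] d[of 1] by (auto intro!: continuous_at_imp_continuous_on differentiable_imp_continuous_within)
  show "(f has_real_derivative deriv f x) (at x)" for x
    using d[of 0 x] by (simp add: DERIV_deriv_iff_real_differentiable)
qed

lemma periodic_S1_pi: "periodic_S1 f \<Longrightarrow> f (- pi) = f pi"
  using spec[of "\<lambda>x. f (x + 2 * pi) = f x" "- pi"] by (simp add: periodic_S1_def)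

lemma glue_upper: "0 \<le> x \<Longrightarrow> x \<le> pi \<Longrightarrow> glue a b x = a x"
  by (simp add: glue_def arccos_cos sin_ge_zero)

lemma glue_lower: "- pi < x \<Longrightarrow> x < 0 \<Longrightarrow> glue a b x = b (- x)"
  using sin_gt_zero[of "- x"] arccos_cos2[of x] by (simp add: glue_def)

lemma increasing_primitive:
  assumes "continuous_on UNIV N" "\<And>x. 0 < N x"
  obtains P :: "real \<Rightarrow> real" where "\<And>x. x \<in> {-pi..pi} \<Longrightarrow> (P has_real_derivative N x) (at x within {-pi..pi})"
    "P (- pi) < P 0" "P 0 < P pi"
proof -
  define P where "P x = integral {-pi..x} N" for x
  have P: "(P has_real_derivative N x) (at x within {-pi..pi})" if "x \<in> {-pi..pi}" for x
    unfolding P_def using that assms(1) by (intro integral_has_real_derivative) (auto intro: continuous_on_subset)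
  have cont: "continuous_on {-pi..pi} P" using P DERIV_continuous_on by blast
  have lt: "P s < P t" if "- pi \<le> s" "s < t" "t \<le> pi" for s t
  proof (rule DERIV_pos_imp_increasing_open[OF that(2)])
    show "\<exists>y. DERIV P x :> y \<and> 0 < y" if "s < x" "x < t" for x
      using P[of x] at_within_Icc_at[of "- pi" x pi] assms(2)[of x] that \<open>- pi \<le> s\<close> \<open>t \<le> pi\<close> by auto
    show "continuous_on {s..t} P" by (rule continuous_on_subset[OF cont]) (use that in auto)
  qed
  show ?thesis by (rule that[OF P]) (auto intro: lt)
qed

text \<open>Integrate a step function against \<open>deriv \<psi>\<close> on each half; periodicity
  of \<open>\<psi>\<close> identifies the boundary values at both ends.\<close>

lemma weak_jump_equation:
  assumes k: "k \<in> borel_measurable borel" "\<And>x. x \<in> {0..pi} \<Longrightarrow> k x = c1" "\<And>x. x \<in> {-pi<..<0} \<Longrightarrow> k x = c2"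
      "k (- pi) = c1"
    and \<psi>: "smooth_S1 \<psi>"
  shows "(LBINT x:{-pi..pi}. k x * deriv \<psi> x) = (c1 - c2) * (\<psi> pi - \<psi> 0)"
proof -
  note S = smooth_S1_continuous[OF \<psi>]
  have per: "\<psi> (- pi) = \<psi> pi" using \<psi> periodic_S1_pi by (simp add: smooth_S1_def)
  have kval: "k x = c1 \<or> k x = c2" if "x \<in> {-pi..pi}" for x
    using k(2)[of x] k(3)[of x] k(4) that by (cases "x = - pi"; cases "x < 0") auto
  have "bounded (deriv \<psi> ` {-pi..pi})"
    by (intro compact_imp_bounded compact_continuous_image continuous_on_subset[OF S(2)]) auto
  then obtain B where B: "\<And>x. x \<in> {-pi..pi} \<Longrightarrow> \<bar>deriv \<psi> x\<bar> \<le> B"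
    unfolding bounded_iff real_norm_def by blast
  have int: "set_integrable lborel {-pi..pi} (\<lambda>x. k x * deriv \<psi> x)"
  proof (rule set_integrable_bounded_Icc[where B = "(\<bar>c1\<bar> + \<bar>c2\<bar>) * B"])
    show "(\<lambda>x. k x * deriv \<psi> x) \<in> borel_measurable borel"
      using k(1) borel_measurable_continuous_onI[OF S(2)] by measurable
    show "\<bar>k x * deriv \<psi> x\<bar> \<le> (\<bar>c1\<bar> + \<bar>c2\<bar>) * B" if "x \<in> {-pi..pi}" for x
      using kval[OF that] B[OF that] unfolding abs_mult by (intro mult_mono) auto
  qed
  \<comment> \<open>Subtracting \<open>\<psi> 0\<close> makes both pieces vanish at
    \<open>0\<close>, so the primitive is continuous across the jump.\<close>
  define F where "F x = (if x \<le> 0 then c2 * (\<psi> x - \<psi> 0) else c1 * (\<psi> x - \<psi> 0))" for x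
  have "((\<lambda>x. k x * deriv \<psi> x) has_integral (F pi - F (- pi))) {-pi..pi}"
  proof (rule fundamental_theorem_of_calculus_interior_strong[of "{0}"])
    show "continuous_on {-pi..pi} F"
    proof -
      have "continuous_on ({-pi..0} \<union> {0..pi}) F"
        unfolding F_def
        by (intro continuous_on_cases continuous_intros continuous_on_subset[OF S(1)]) auto
      then show ?thesis by (simp add: ivl_disj_un_two_touch(4))
    qed
    fix x assume x: "x \<in> {-pi<..<pi} - {0}"
    have D: "((\<lambda>x. c * (\<psi> x - \<psi> 0)) has_real_derivative c * deriv \<psi> x) (at x)" for c
      by (auto intro!: derivative_eq_intros S(3))
    have "(F has_real_derivative k x * deriv \<psi> x) (at x)"
    proof (cases "x < 0")
      case True
      then have "k x = c2" using k(3) x by auto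
      then show ?thesis
        using has_field_derivative_transform_within_open[OF D[of c2], of "{..<0}" F] True
        by (auto simp: F_def)
    next
      case False
      then have "k x = c1" using k(2) x by auto
      then show ?thesis
        using has_field_derivative_transform_within_open[OF D[of c1], of "{0<..}" F] False x
        by (auto simp: F_def)
    qed
    then show "(F has_vector_derivative k x * deriv \<psi> x) (at x)"
      by (simp add: has_real_derivative_iff_has_vector_derivative)
  qed auto
  then have "integral {-pi..pi} (\<lambda>x. k x * deriv \<psi> x) = (c1 - c2) * (\<psi> pi - \<psi> 0)"
    using pi_gt_zero by (simp add: integral_unique F_def per not_le algebra_simps)
  then show ?thesis using set_borel_integral_eq_integral(2)[OF int] by simp
qed

theorem theorem3p4:
  fixes n :: nat and N :: "real \<Rightarrow> real" and \<eta> \<mu> t :: real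
  assumes "n \<ge> 3"
    and "smooth_S1 N" and "\<forall>x. N x > 0"
    and "\<bar>t\<bar> > 1"
    and "\<mu> \<noteq> 0 \<or> \<eta> \<noteq> 0"
  shows "\<exists>p > 1. \<exists>\<phi> w. is_solution n N \<eta> \<mu> t p \<phi> w"
proof -
  define q \<kappa> where "q = q_exp n" and "\<kappa> = kappa n"
  have q: "2 < q" using assms(1) by (simp add: q_def q_exp_def field_simps)
  have \<kappa>: "0 < \<kappa>" using assms(1) by (simp add: \<kappa>_def kappa_def)
  have cN: "continuous_on UNIV N" using smooth_S1_continuous assms(2) by blast
  have Npos: "0 < N x" for x using assms(3) by blast
  obtain P where P: "\<And>x. x \<in> {-pi..pi} \<Longrightarrow> (P has_real_derivative N x) (at x within {-pi..pi})"
      "P (- pi) < P 0" "P 0 < P pi"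
    using increasing_primitive[OF cN Npos] by blast
  \<comment> \<open>The solution of
    \<open>(g + 1) * (P pi - P 0) + (g - 1) * (P 0 - P (- pi)) = 0\<close>, which says that
    \<open>N (\<lambda> + g)\<close> has mean zero. As a weighted mean of \<open>1\<close> and
    \<open>-1\<close> it has modulus at most \<open>1\<close>.\<close>
  define g where "g = (2 * P 0 - P (- pi) - P pi) / (P pi - P (- pi))"
  have den: "0 < P pi - P (- pi)" using P(2,3) by linarith
  have g: "\<bar>g\<bar> \<le> 1"
    using P(2,3) den by (simp add: g_def abs_le_iff divide_le_eq minus_divide_left)
  have gP: "(g + 1) * (P pi - P 0) = (g - 1) * (P (- pi) - P 0)"
    using den by (simp add: g_def divide_simps) (simp add: algebra_simps)
  define \<alpha> where "\<alpha> = 2 * \<eta>\<^sup>2 / \<kappa>"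
  have \<alpha>: "0 \<le> \<alpha>" "\<alpha> \<noteq> 0 \<or> \<mu> \<noteq> 0" using \<kappa> assms(5) by (auto simp: \<alpha>_def)
  define A where "A s c = \<alpha> + (\<mu> + c powr q * (g + s))\<^sup>2" for s c :: real
  have A1: "A 1 c = \<alpha> + (\<mu> + c powr q * (g + 1))\<^sup>2"
    and A2: "A (- 1) c = \<alpha> + (\<mu> + c powr q * (g - 1))\<^sup>2" for c
    by (simp_all add: A_def)
  have half_pi: "0 < pi / 2" by simp
  obtain c u u1 v v1 where "0 < c"
    and u: "mixed_bvp (pi / 2) (lich q \<bar>t + 1\<bar> (A 1 c)) c u u1" "\<And>x. x \<in> {0..pi / 2} \<Longrightarrow> 0 < u x"
    and v: "mixed_bvp (pi / 2) (lich q \<bar>t - 1\<bar> (A (- 1) c)) c v v1" "\<And>x. x \<in> {0..pi / 2} \<Longrightarrow> 0 < v x"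
    and match: "u1 0 + v1 0 = 0"
    using matched_profiles[OF half_pi q assms(4) \<alpha> g] unfolding A1 A2 by blast
  define fp where "fp = lich q \<bar>t + 1\<bar> (A 1 c)"
  define fm where "fm = lich q \<bar>t - 1\<bar> (A (- 1) c)"
  obtain a a1 where a: "a 0 = c" "a pi = c" "a1 0 = u1 0" "a1 pi = - u1 0"
    "\<And>x. x \<in> {0..pi} \<Longrightarrow> 0 < a x"
    "\<And>x. x \<in> {0..pi} \<Longrightarrow> (a has_real_derivative a1 x) (at x within {0..pi})"
    "\<And>x. x \<in> {0..pi} \<Longrightarrow> (a1 has_real_derivative fp (a x)) (at x within {0..pi})"
    using mixed_bvp_reflect[OF _ u] unfolding fp_def by auto
  obtain b b1 where b: "b 0 = c" "b pi = c" "b1 0 = v1 0" "b1 pi = - v1 0"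
    "\<And>x. x \<in> {0..pi} \<Longrightarrow> 0 < b x"
    "\<And>x. x \<in> {0..pi} \<Longrightarrow> (b has_real_derivative b1 x) (at x within {0..pi})"
    "\<And>x. x \<in> {0..pi} \<Longrightarrow> (b1 has_real_derivative fm (b x)) (at x within {0..pi})"
    using mixed_bvp_reflect[OF _ v] unfolding fm_def by auto
  have cont_f: "continuous_on {0..pi} (\<lambda>x. lich q T B (h x))"
    if "\<And>x. x \<in> {0..pi} \<Longrightarrow> 0 < h x" "\<And>x. x \<in> {0..pi} \<Longrightarrow> (h has_real_derivative h1 x) (at x within {0..pi})"
    for T B h h1
    by (rule continuous_on_compose2[OF continuous_on_lich DERIV_continuous_on[OF that(2)]])
      (use q that in auto)
  define Y where "Y = c powr q"
  \<comment> \<open>The value of \<open>w\<close> at \<open>x = s * r\<close>, with \<open>s\<close>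
    the sign of the half circle and \<open>r\<close> the distance from \<open>0\<close>; thus
    \<open>w 0 = 0\<close>.\<close>
  define W where "W s r = 2 * Y * (g + s) * (P (s * r) - P 0)" for s r :: real
  have W: "(W s has_real_derivative s * (2 * Y * (g + s) * N (s * r))) (at r within {0..pi})"
    if r: "r \<in> {0..pi}" and s: "s = 1 \<or> s = - 1" for s r
  proof -
    have "((\<lambda>r. s * r) has_real_derivative s) (at r within {0..pi})"
      by (auto intro!: derivative_eq_intros)
    then have "(P \<circ> (\<lambda>r. s * r) has_real_derivative N (s * r) * s) (at r within {0..pi})"
      using r s by (intro DERIV_image_chain has_field_derivative_subset[OF P(1)]) auto
    then have D: "((\<lambda>r. P (s * r)) has_real_derivative N (s * r) * s) (at r within {0..pi})"
      by (simp add: o_def)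
    show ?thesis unfolding W_def by (auto intro!: derivative_eq_intros D)
  qed
  \<comment> \<open>Each differentiation of the lower arc changes the sign once, so the second
    derivative carries two minus signs.\<close>
  define \<phi> \<phi>1 \<phi>2 where "\<phi> = glue a b" and "\<phi>1 = glue a1 (\<lambda>r. - b1 r)"
    and "\<phi>2 = glue (\<lambda>r. fp (a r)) (\<lambda>r. - (- fm (b r)))"
  define w w1 where "w = glue (W 1) (W (- 1))"
    and "w1 = glue (\<lambda>r. 1 * (2 * Y * (g + 1) * N (1 * r))) (\<lambda>r. - (- 1 * (2 * Y * (g + - 1) * N (- 1 * r))))"
  have \<phi>_W1p: "W1p 2 \<phi> \<phi>1"
    unfolding \<phi>_def \<phi>1_def
    by (rule W1p_glue[OF a(6) b(6) DERIV_continuous_on[OF a(7)] DERIV_continuous_on[OF b(7)]]) (use a b in auto)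
  \<comment> \<open>Continuity of \<open>\<phi>1\<close> at both junctions is the identity
    \<open>match\<close>, since reflection gives opposite end slopes on each arc.\<close>
  have \<phi>1_W1p: "W1p 2 \<phi>1 \<phi>2"
    unfolding \<phi>1_def \<phi>2_def
  proof (rule W1p_glue[OF a(7) DERIV_minus[OF b(7)]])
    show "continuous_on {0..pi} (\<lambda>r. fp (a r))" unfolding fp_def by (rule cont_f[OF a(5,6)])
    show "continuous_on {0..pi} (\<lambda>r. - fm (b r))"
      unfolding fm_def by (intro continuous_on_minus cont_f[OF b(5,6)])
  qed (use a b match in auto)
  have w_W1p: "W1p 2 w w1"
    unfolding w_def w1_def
  proof (rule W1p_glue[OF W W])
    \<comment> \<open>The choice of \<open>g\<close> is what closes \<open>w\<close> up at the
      antipodal point.\<close>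
    show "W 1 pi = W (- 1) pi" using gP by (simp add: W_def)
  qed (auto simp: W_def intro!: continuous_intros continuous_on_compose2[OF cN])
  have pos: "0 < \<phi> x" for x
    unfolding \<phi>_def glue_def using a(5) b(5) arccos_cos_mem[of x] by auto
  have w1_up: "w1 x / (2 * N x) = Y * (g + 1)" if "x \<in> {0..pi}" for x
    using that Npos[of x] by (simp add: w1_def glue_upper)
  have w1_lo: "w1 x / (2 * N x) = Y * (g - 1)" if "x \<in> {-pi<..<0}" for x
    using that Npos[of x] by (simp add: w1_def glue_lower)
  have eq1: "- 2 * \<kappa> * q * \<phi>2 x - 2 * \<eta>\<^sup>2 * \<phi> x powr (- q - 1)
      - \<kappa> * (\<mu> + w1 x / (2 * N x))\<^sup>2 * \<phi> x powr (- q - 1)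
      + \<kappa> * (t + lam x)\<^sup>2 * \<phi> x powr (q - 1) = 0" if x: "x \<in> {-pi<..<pi}" for x
  proof -
    have alg: "- 2 * \<kappa> * q * lich q \<bar>t + s\<bar> (A s c) z - 2 * \<eta>\<^sup>2 * z powr (- q - 1)
      - \<kappa> * (\<mu> + Y * (g + s))\<^sup>2 * z powr (- q - 1)
      + \<kappa> * (t + s)\<^sup>2 * z powr (q - 1) = 0" for s z
    proof -
      have e: "\<kappa> * A s c = 2 * \<eta>\<^sup>2 + \<kappa> * (\<mu> + Y * (g + s))\<^sup>2"
        using \<kappa> by (simp add: A_def \<alpha>_def Y_def distrib_left)
      have "2 * \<kappa> * q * lich q \<bar>t + s\<bar> (A s c) z
          = \<kappa> * (t + s)\<^sup>2 * z powr (q - 1) - (\<kappa> * A s c) * z powr (- q - 1)"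
        using q by (simp add: lich_def field_simps)
      then show ?thesis unfolding e by (simp add: algebra_simps)
    qed
    show ?thesis
    proof (cases "0 \<le> x")
      case True
      then show ?thesis using x alg[of 1 "a x"] w1_up[of x]
        by (simp add: \<phi>_def \<phi>2_def glue_upper lam_def fp_def)
    next
      case False
      then show ?thesis using x alg[of "- 1" "b (- x)"] w1_lo[of x]
        by (simp add: \<phi>_def \<phi>2_def glue_lower lam_def fm_def)
    qed
  qed
  have eq2: "- (LBINT x:{-pi..pi}. w1 x / (2 * N x) * deriv \<psi> x)
      - (2 * \<phi> 0 powr q * \<psi> 0 - 2 * \<phi> pi powr q * \<psi> pi) = 0" if \<psi>: "smooth_S1 \<psi>" for \<psi>
  proof -
    have "(LBINT x:{-pi..pi}. w1 x / (2 * N x) * deriv \<psi> x) = (Y * (g + 1) - Y * (g - 1)) * (\<psi> pi - \<psi> 0)"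
    proof (rule weak_jump_equation[OF _ w1_up w1_lo _ \<psi>])
      show "(\<lambda>x. w1 x / (2 * N x)) \<in> borel_measurable borel"
        using w_W1p borel_measurable_continuous_onI[OF cN] by (auto simp: W1p_def)
      show "w1 (- pi) / (2 * N (- pi)) = Y * (g + 1)"
        using w1_up[of pi] periodic_S1_pi[of N] periodic_S1_pi[of w1] assms(2) w_W1p
        by (simp add: smooth_S1_def W1p_def)
    qed
    moreover have "\<phi> 0 powr q = Y" "\<phi> pi powr q = Y"
      using a by (simp_all add: \<phi>_def glue_upper Y_def)
    ultimately show ?thesis by (simp add: algebra_simps)
  qed
  have "is_solution n N \<eta> \<mu> t 2 \<phi> w"
    unfolding is_solution_def q_def[symmetric] \<kappa>_def[symmetric]
    by (intro exI[of _ \<phi>1] exI[of _ \<phi>2] exI[of _ w1] conjI \<phi>_W1p \<phi>1_W1p w_W1p allI pos impI eq2 AE_I2 eq1)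
  then show ?thesis by (intro exI[of _ 2]) auto
qed

end
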